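(* Let $k\{Y\}=k\{y_1,\ldots,y_l\}$ be a ring of differential polynomials over a differential field $k$ of characteristic zero, with a fixed ranking. Let $\mathbb{C} = C_1,\ldots,C_p$ be the canonical characteristic set of a characterizable differential ideal $I$, with set of non-leaders $N$. Let $\mathbb{B}=B_1,\ldots,B_p$ be any characteristic set of $I$ such that the initials of $\mathbb{B}$ depend only on the non-leaders $N$. Then $$I_{C_i} \leq_{\rm lex} I_{B_i}$$ for all $i$, $1\leq i\leq p$.
   Context: $\Delta=\{\delta_1,\ldots,\delta_n\}$ is a finite set of commuting derivations, $\Theta$ the free commutative monoid of derivative operators $\delta_1^{k_1}\cdots\delta_n^{k_n}$. $k\{Y\}$ is the polynomial ring over $k$ in the differential variables $\Theta Y=\{\theta y_j\}$. $[F]$ is the differential ideal generated by $F$. A ranking is a total order on $\Theta Y$ such that $\theta u\geq u$ and ($u\geq v\Rightarrow\theta u\geq\theta v$). The leader $u_f$ of $f\notin k$ is the highest differential variable in $f$; if $d=\deg_{u_f}f$, the initial $I_f$ is the coefficient of $u_f^d$, the separant is $S_f=\partial f/\partial u_f$, and the rank is $u_f^d$. Ranks are compared by $u^{d}>v^{e}$ iff $u>v$, or $u=v$ and $d>e$. $f$ is reduced with respect to $g$ if no proper derivative of $u_g$ appears in $f$ and $\deg_{u_g}f<\deg_{u_g}g$. A set $\mathbb{A}\subset k\{Y\}\setminus k$ is autoreduced if each element is reduced with respect to all the others; such sets are finite and written in order of increasing rank. $\mathbb{A}=A_1,\ldots,A_r$ has lower rank than $\mathbb{B}=B_1,\ldots,B_s$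 if there is $j\le r,s$ with $\operatorname{rank}A_i=\operatorname{rank}B_i$ for $i<j$ and $\operatorname{rank}A_j<\operatorname{rank}B_j$, or if $r>s$ and $\operatorname{rank}A_i=\operatorname{rank}B_i$ for $1\le i\le s$. A characteristic set of an ideal is an autoreduced subset of it of lowest rank. $H_{\mathbb{A}}$ is the product of the initials and separants of the elements of $\mathbb{A}$, and $J:H_{\mathbb{A}}^\infty=\{a : H_{\mathbb{A}}^m a\in J\text{ for some }m\geq0\}$. A differential ideal $I$ is characterizable if $I=[\mathbb{A}]:H_{\mathbb{A}}^\infty$ for some characteristic set $\mathbb{A}$ of $I$. All characteristic sets of $I$ have the same set of leaders $L$; the set of non-leaders is $N=\Theta Y\setminus\Theta L$. $>_{\rm lex}$ is the lexicographic order on power products of differential variables induced by the ranking (compare exponents at the highest variable where they differ). It extends to a partial (quasi-)order on differential polynomials by comparing supports: $f\leq_{\rm lex}g$ if $f$ and $g$ have the same set of monomials, or the $>_{\rm lex}$-largest monomial occurring in exactly one of $f,g$ occurs in $g$. A characteristic set $\mathbb{C}=C_1,\ldots,C_p$ of a characterizable ideal $I$ is canonical if (1) $I_{C_i}\in k[N]$ for all $i$; (2) for each $i$, $C_i$ has no factors in $k[N]$ (other than constants of $k$), and the coefficient in $I_{C_i}$ of its leading monomial with respect to $>_{\rm lex}$ equals $1$. The canonical characteristic set exists and is unique. *)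

theory Defs
  imports Complex_Main "HOL-Library.Poly_Mapping"
begin

section \<open>Polynomials in arbitrarily many variables\<close>

type_synonym 'v monomial = "'v \<Rightarrow>\<^sub>0 nat"
type_synonym ('v, 'k) pol = "'v monomial \<Rightarrow>\<^sub>0 'k"

definition vars :: "('v, 'k::zero) pol \<Rightarrow> 'v set" where
  "vars f = (\<Union>m\<in>Poly_Mapping.keys f. Poly_Mapping.keys m)"

definition Const :: "'k::zero \<Rightarrow> ('v, 'k) pol" where
  "Const c = Poly_Mapping.single 0 c"

definition Var :: "'v \<Rightarrow> ('v, 'k::zero_neq_one) pol" where
  "Var v = Poly_Mapping.single (Poly_Mapping.single v 1) 1"

definition pol_ring_in :: "'v set \<Rightarrow> ('v, 'k::zero) pol set" where
  "pol_ring_in N = {f. vars f \<subseteq> N}"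

text \<open>The element 0 is inserted only so that the zero polynomial has degree 0.\<close>

definition deg_in :: "'v \<Rightarrow> ('v, 'k::zero) pol \<Rightarrow> nat" where
  "deg_in v f = Max (insert 0 ((\<lambda>m. Poly_Mapping.lookup m v) ` Poly_Mapping.keys f))"

definition coeff_in :: "'v \<Rightarrow> nat \<Rightarrow> ('v, 'k::comm_monoid_add) pol \<Rightarrow> ('v, 'k) pol" where
  "coeff_in v d f =
     (\<Sum>m | m \<in> Poly_Mapping.keys f \<and> Poly_Mapping.lookup m v = d.
        Poly_Mapping.single (m - Poly_Mapping.single v d) (Poly_Mapping.lookup f m))"

text \<open>Monomials not containing \<open>v\<close> contribute 0, so the truncated exponent does no harm.\<close>

definition partial_deriv :: "'v \<Rightarrow> ('v, 'k::semiring_1) pol \<Rightarrow> ('v, 'k) pol" where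
  "partial_deriv v f =
     (\<Sum>m\<in>Poly_Mapping.keys f.
        Poly_Mapping.single (m - Poly_Mapping.single v 1)
          (of_nat (Poly_Mapping.lookup m v) * Poly_Mapping.lookup f m))"


section \<open>Differential fields and differential polynomials\<close>

definition commuting_derivations :: "('d \<Rightarrow> 'k \<Rightarrow> 'k::field) \<Rightarrow> bool" where
  "commuting_derivations \<delta> \<longleftrightarrow>
     (\<forall>i a b. \<delta> i (a + b) = \<delta> i a + \<delta> i b) \<and>
     (\<forall>i a b. \<delta> i (a * b) = \<delta> i a * b + a * \<delta> i b) \<and>
     (\<forall>i j a. \<delta> i (\<delta> j a) = \<delta> j (\<delta> i a))"

text \<open>
  A derivative operator is given by its exponents; composition of operators is addition.
  The pair \<open>(j, \<theta>)\<close> stands for the differential variable \<open>\<theta> y\<^sub>j\<close>.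
\<close>

type_synonym 'd dop = "'d \<Rightarrow>\<^sub>0 nat"
type_synonym ('d, 'y) dvar = "'y \<times> 'd dop"
type_synonym ('d, 'y, 'k) dpol = "(('d, 'y) dvar, 'k) pol"

definition derive_var :: "'d dop \<Rightarrow> ('d, 'y) dvar \<Rightarrow> ('d, 'y) dvar" where
  "derive_var \<theta> u = (fst u, \<theta> + snd u)"

text \<open>
  The derivation of the polynomial ring that extends \<open>\<delta> i\<close> and sends each differential
  variable \<open>u\<close> to \<open>\<delta>\<^sub>i u\<close>: apply \<open>\<delta> i\<close> to all coefficients and add the chain rule terms.
\<close>

definition dpol_deriv ::
  "('d \<Rightarrow> 'k \<Rightarrow> 'k::field) \<Rightarrow> 'd \<Rightarrow> ('d, 'y, 'k) dpol \<Rightarrow> ('d, 'y, 'k) dpol" where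
  "dpol_deriv \<delta> i f =
     Poly_Mapping.map (\<delta> i) f +
     (\<Sum>u\<in>vars f. partial_deriv u f * Var (derive_var (Poly_Mapping.single i 1) u))"

definition differential_ideal ::
  "('d \<Rightarrow> 'k \<Rightarrow> 'k::field) \<Rightarrow> ('d, 'y, 'k) dpol set \<Rightarrow> bool" where
  "differential_ideal \<delta> J \<longleftrightarrow>
     0 \<in> J \<and>
     (\<forall>f\<in>J. \<forall>g\<in>J. f + g \<in> J) \<and>
     (\<forall>f\<in>J. \<forall>g. g * f \<in> J) \<and>
     (\<forall>f\<in>J. \<forall>i. dpol_deriv \<delta> i f \<in> J)"

definition differential_ideal_gen ::
  "('d \<Rightarrow> 'k \<Rightarrow> 'k::field) \<Rightarrow> ('d, 'y, 'k) dpol set \<Rightarrow> ('d, 'y, 'k) dpol set" where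
  "differential_ideal_gen \<delta> F = \<Inter> {J. differential_ideal \<delta> J \<and> F \<subseteq> J}"

definition saturation :: "'a::comm_monoid_mult set \<Rightarrow> 'a \<Rightarrow> 'a set" where
  "saturation J h = {a. \<exists>m::nat. h ^ m * a \<in> J}"


section \<open>Rankings, leaders, initials and separants\<close>

text \<open>A relation \<open>R\<close> is read as \<open>(u, v) \<in> R\<close> iff \<open>u \<le> v\<close>.\<close>

definition ranking :: "('d, 'y) dvar rel \<Rightarrow> bool" where
  "ranking R \<longleftrightarrow>
     linear_order R \<and>
     (\<forall>\<theta> u. (u, derive_var \<theta> u) \<in> R) \<and>
     (\<forall>\<theta> u v. (v, u) \<in> R \<longrightarrow> (derive_var \<theta> v, derive_var \<theta> u) \<in> R)"

text \<open>The following notions are only meaningful for \<open>f\<close> outside the coefficient field.\<close>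

definition leader :: "'v rel \<Rightarrow> ('v, 'k::zero) pol \<Rightarrow> 'v" where
  "leader R f = (THE u. u \<in> vars f \<and> (\<forall>v\<in>vars f. (v, u) \<in> R))"

definition ldeg :: "'v rel \<Rightarrow> ('v, 'k::zero) pol \<Rightarrow> nat" where
  "ldeg R f = deg_in (leader R f) f"

definition initial :: "'v rel \<Rightarrow> ('v, 'k::comm_monoid_add) pol \<Rightarrow> ('v, 'k) pol" where
  "initial R f = coeff_in (leader R f) (ldeg R f) f"

definition separant :: "'v rel \<Rightarrow> ('v, 'k::semiring_1) pol \<Rightarrow> ('v, 'k) pol" where
  "separant R f = partial_deriv (leader R f) f"

definition rank :: "'v rel \<Rightarrow> ('v, 'k::zero) pol \<Rightarrow> 'v \<times> nat" where
  "rank R f = (leader R f, ldeg R f)"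

definition rank_less :: "'v rel \<Rightarrow> 'v \<times> nat \<Rightarrow> 'v \<times> nat \<Rightarrow> bool" where
  "rank_less R p q \<longleftrightarrow>
     (fst p \<noteq> fst q \<and> (fst p, fst q) \<in> R) \<or> (fst p = fst q \<and> snd p < snd q)"


section \<open>Autoreduced and characteristic sets\<close>

definition reduced_wrt ::
  "('d, 'y) dvar rel \<Rightarrow> ('d, 'y, 'k::zero) dpol \<Rightarrow> ('d, 'y, 'k) dpol \<Rightarrow> bool" where
  "reduced_wrt R f g \<longleftrightarrow>
     (\<forall>\<theta>. \<theta> \<noteq> 0 \<longrightarrow> derive_var \<theta> (leader R g) \<notin> vars f) \<and>
     deg_in (leader R g) f < deg_in (leader R g) g"

definition autoreduced :: "('d, 'y) dvar rel \<Rightarrow> ('d, 'y, 'k::zero) dpol set \<Rightarrow> bool" where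
  "autoreduced R A \<longleftrightarrow>
     A \<inter> range Const = {} \<and> (\<forall>f\<in>A. \<forall>g\<in>A. f \<noteq> g \<longrightarrow> reduced_wrt R f g)"

text \<open>
  Autoreduced sets are finite and their elements have pairwise different ranks, so each of
  them is represented by exactly one list in order of increasing rank.
\<close>

definition autoreduced_list ::
  "('d, 'y) dvar rel \<Rightarrow> ('d, 'y, 'k::zero) dpol list \<Rightarrow> bool" where
  "autoreduced_list R A \<longleftrightarrow>
     autoreduced R (set A) \<and> sorted_wrt (\<lambda>f g. rank_less R (rank R f) (rank R g)) A"

definition lower_rank ::
  "'v rel \<Rightarrow> ('v, 'k::zero) pol list \<Rightarrow> ('v, 'k) pol list \<Rightarrow> bool" where
  "lower_rank R A B \<longleftrightarrow>
     (\<exists>j. j < length A \<and> j < length B \<and>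
        (\<forall>i<j. rank R (A ! i) = rank R (B ! i)) \<and>
        rank_less R (rank R (A ! j)) (rank R (B ! j))) \<or>
     (length A > length B \<and> (\<forall>i<length B. rank R (A ! i) = rank R (B ! i)))"

definition characteristic_set ::
  "('d, 'y) dvar rel \<Rightarrow> ('d, 'y, 'k::zero) dpol set \<Rightarrow> ('d, 'y, 'k) dpol list \<Rightarrow> bool" where
  "characteristic_set R I A \<longleftrightarrow>
     autoreduced_list R A \<and> set A \<subseteq> I \<and>
     \<not> (\<exists>B. autoreduced_list R B \<and> set B \<subseteq> I \<and> lower_rank R B A)"

definition init_sep_prod :: "'v rel \<Rightarrow> ('v, 'k::comm_semiring_1) pol list \<Rightarrow> ('v, 'k) pol" where
  "init_sep_prod R A = (\<Prod>f\<leftarrow>A. initial R f * separant R f)"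

definition characterizable ::
  "('d \<Rightarrow> 'k \<Rightarrow> 'k::field) \<Rightarrow> ('d, 'y) dvar rel \<Rightarrow> ('d, 'y, 'k) dpol set \<Rightarrow> bool" where
  "characterizable \<delta> R I \<longleftrightarrow>
     differential_ideal \<delta> I \<and>
     (\<exists>A. characteristic_set R I A \<and>
        I = saturation (differential_ideal_gen \<delta> (set A)) (init_sep_prod R A))"

definition nonleaders ::
  "('d, 'y) dvar rel \<Rightarrow> ('d, 'y, 'k::zero) dpol list \<Rightarrow> ('d, 'y) dvar set" where
  "nonleaders R A = UNIV - {derive_var \<theta> (leader R f) | \<theta> f. f \<in> set A}"


section \<open>Lexicographic comparison and canonical characteristic sets\<close>

definition lex_less :: "'v rel \<Rightarrow> 'v monomial \<Rightarrow> 'v monomial \<Rightarrow> bool" where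
  "lex_less R s t \<longleftrightarrow>
     (\<exists>v. Poly_Mapping.lookup s v < Poly_Mapping.lookup t v \<and>
        (\<forall>w. w \<noteq> v \<and> (v, w) \<in> R \<longrightarrow> Poly_Mapping.lookup s w = Poly_Mapping.lookup t w))"

definition is_lex_max :: "'v rel \<Rightarrow> 'v monomial set \<Rightarrow> 'v monomial \<Rightarrow> bool" where
  "is_lex_max R M m \<longleftrightarrow> m \<in> M \<and> (\<forall>m'\<in>M. m' \<noteq> m \<longrightarrow> lex_less R m' m)"

definition lex_leading_coeff :: "'v rel \<Rightarrow> ('v, 'k::zero) pol \<Rightarrow> 'k" where
  "lex_leading_coeff R f =
     Poly_Mapping.lookup f (THE m. is_lex_max R (Poly_Mapping.keys f) m)"

definition lex_le :: "'v rel \<Rightarrow> ('v, 'k::zero) pol \<Rightarrow> ('v, 'k) pol \<Rightarrow> bool" where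
  "lex_le R f g \<longleftrightarrow>
     Poly_Mapping.keys f = Poly_Mapping.keys g \<or>
     (\<exists>m\<in>Poly_Mapping.keys g.
        is_lex_max R ((Poly_Mapping.keys f - Poly_Mapping.keys g) \<union>
                      (Poly_Mapping.keys g - Poly_Mapping.keys f)) m)"

definition canonical_characteristic_set ::
  "('d, 'y) dvar rel \<Rightarrow> ('d, 'y, 'k::field) dpol set \<Rightarrow> ('d, 'y, 'k) dpol list \<Rightarrow> bool" where
  "canonical_characteristic_set R I C \<longleftrightarrow>
     characteristic_set R I C \<and>
     (\<forall>f\<in>set C. initial R f \<in> pol_ring_in (nonleaders R C)) \<and>
     (\<forall>f\<in>set C.
        (\<forall>g\<in>pol_ring_in (nonleaders R C). g dvd f \<longrightarrow> g \<in> range Const) \<and>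
        lex_leading_coeff R (initial R f) = 1)"


section \<open>Consequences of the definitions\<close>

lemma dpol_deriv_Const:
  fixes \<delta> :: "'d \<Rightarrow> 'k \<Rightarrow> 'k::field"
  assumes "commuting_derivations \<delta>"
  shows "dpol_deriv \<delta> i (Const c) = (Const (\<delta> i c) :: ('d, 'y, 'k) dpol)"
proof -
  have z: "\<delta> i 0 = 0"
    using assms unfolding commuting_derivations_def by (metis add.right_neutral add_left_cancel)
  have "vars (Const c :: ('d, 'y, 'k) dpol) = {}"
    by (simp add: vars_def Const_def)
  moreover have "Poly_Mapping.map (\<delta> i) (Const c) = (Const (\<delta> i c) :: ('d, 'y, 'k) dpol)"
    by (simp add: Const_def z map_single)
  ultimately show ?thesis
    by (simp add: dpol_deriv_def)
qed

lemma dpol_deriv_Var: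
  fixes \<delta> :: "'d \<Rightarrow> 'k \<Rightarrow> 'k::field" and u :: "('d, 'y) dvar"
  assumes "commuting_derivations \<delta>"
  shows "dpol_deriv \<delta> i (Var u) = Var (derive_var (Poly_Mapping.single i 1) u)"
proof -
  have z: "\<delta> i 0 = 0"
    using assms unfolding commuting_derivations_def by (metis add.right_neutral add_left_cancel)
  have "\<delta> i (1 * 1) = \<delta> i 1 * 1 + 1 * \<delta> i 1"
    using assms unfolding commuting_derivations_def by blast
  then have "\<delta> i 1 + 0 = \<delta> i 1 + \<delta> i 1"
    by (simp only: mult_1_left mult_1_right add_0_right)
  then have o: "\<delta> i 1 = 0"
    by (simp only: add_left_cancel)
  have "partial_deriv u (Var u) = (1 :: ('d, 'y, 'k) dpol)"
    by (simp add: partial_deriv_def Var_def)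
  moreover have "vars (Var u :: ('d, 'y, 'k) dpol) = {u}"
    by (simp add: vars_def Var_def)
  moreover have "Poly_Mapping.map (\<delta> i) (Var u :: ('d, 'y, 'k) dpol) = 0"
    by (simp add: Var_def z o map_single)
  ultimately show ?thesis
    by (simp add: dpol_deriv_def)
qed

text \<open>All characteristic sets of an ideal have the same number of elements.\<close>

lemma characteristic_set_same_length:
  assumes R: "ranking R" and A: "characteristic_set R I A" and B: "characteristic_set R I B"
  shows "length A = length B"
proof -
  have tot: "p = q \<or> rank_less R p q \<or> rank_less R q p" for p q
    using R unfolding ranking_def rank_less_def linear_order_on_def total_on_def
    by (metis UNIV_I linorder_neqE_nat prod.expand)
  have le: "length A \<le> length B"
    if A: "characteristic_set R I A" and B: "characteristic_set R I B" for A B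
  proof (rule ccontr)
    assume len: "\<not> length A \<le> length B"
    have nl: "\<not> lower_rank R A B" "\<not> lower_rank R B A"
      using A B unfolding characteristic_set_def by blast+
    with len obtain i where i: "i < length B" "rank R (A ! i) \<noteq> rank R (B ! i)"
      unfolding lower_rank_def by auto
    define j where "j = (LEAST i. i < length B \<and> rank R (A ! i) \<noteq> rank R (B ! i))"
    have j: "j < length B" "rank R (A ! j) \<noteq> rank R (B ! j)"
      using LeastI[of "\<lambda>i. i < length B \<and> rank R (A ! i) \<noteq> rank R (B ! i)" i] i
      unfolding j_def by auto
    have eq: "\<forall>i<j. rank R (A ! i) = rank R (B ! i)"
      using not_less_Least[of _ "\<lambda>i. i < length B \<and> rank R (A ! i) \<noteq> rank R (B ! i)"] j(1)
      unfolding j_def[symmetric] by (metis order_less_trans)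
    have "j < length A"
      using j(1) len by simp
    with j eq tot[of "rank R (A ! j)" "rank R (B ! j)"] nl show False
      unfolding lower_rank_def by metis
  qed
  from le[OF A B] le[OF B A] show ?thesis
    by simp
qed

end

theory Submission
  imports Defs "HOL-Computational_Algebra.Factorial_Ring"
begin

text \<open>
  The elements \<open>C\<^sub>i\<close> and \<open>B\<^sub>i\<close> have the same rank, so \<open>I\<^bsub>C\<^sub>i\<^esub> B\<^sub>i - I\<^bsub>B\<^sub>i\<^esub> C\<^sub>i\<close> has lower rank;
  it lies in \<open>I\<close> and is reduced with respect to \<open>C\<close>, so it vanishes unless \<open>I\<close> is the unit
  ideal, in which case all these initials are constants. As \<open>C\<^sub>i\<close> has no nonconstant factor in
  \<open>k[N]\<close> and irreducible polynomials are prime, \<open>I\<^bsub>C\<^sub>i\<^esub> B\<^sub>i = I\<^bsub>B\<^sub>i\<^esub> C\<^sub>i\<close> implies that \<open>I\<^bsub>C\<^sub>i\<^esub>\<close> divides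
  \<open>I\<^bsub>B\<^sub>i\<^esub>\<close>. Finally a multiple is lexicographically at least as large, since leading monomials are
  multiplicative.
\<close>


abbreviation "lookup \<equiv> Poly_Mapping.lookup"
abbreviation "keys \<equiv> Poly_Mapping.keys"
abbreviation "single \<equiv> Poly_Mapping.single"

section \<open>Leading monomials\<close>

lemma keys_empty_iff [simp]: "keys f = {} \<longleftrightarrow> f = 0"
  by (auto simp: in_keys_iff intro: poly_mapping_eqI)

lemma linear_orderD:
  assumes "linear_order R"
  shows "(u, u) \<in> R" "(u, v) \<in> R \<Longrightarrow> (v, u) \<in> R \<Longrightarrow> u = v"
    "(u, v) \<in> R \<Longrightarrow> (v, w) \<in> R \<Longrightarrow> (u, w) \<in> R" "(u, v) \<in> R \<or> (v, u) \<in> R"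
proof -
  have r: "refl R" "trans R" "antisym R" "total R"
    using assms by (auto simp: linear_order_on_def partial_order_on_def preorder_on_def)
  show refl: "(u, u) \<in> R" for u using r(1) by (simp add: refl_on_def)
  show "(u, v) \<in> R \<Longrightarrow> (v, u) \<in> R \<Longrightarrow> u = v" using r(3) by (rule antisymD)
  show "(u, v) \<in> R \<Longrightarrow> (v, w) \<in> R \<Longrightarrow> (u, w) \<in> R" using r(2) by (rule transD)
  show "(u, v) \<in> R \<or> (v, u) \<in> R" using r(4) refl by (cases "u = v") (auto simp: total_on_def)
qed

lemma finite_linear_order_max:
  assumes "linear_order R" "finite D" "D \<noteq> {}"
  shows "\<exists>v\<in>D. \<forall>w\<in>D. (w, v) \<in> R"
  using assms(2,3)
proof (induction rule: finite_ne_induct)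
  case (singleton x)
  then show ?case using linear_orderD(1)[OF assms(1)] by simp
next
  case (insert x F)
  then obtain v where "v \<in> F" "\<forall>w\<in>F. (w, v) \<in> R" by blast
  then show ?case
    using linear_orderD(1,4)[OF assms(1)] linear_orderD(3)[OF assms(1), of _ v x]
    by (cases "(v, x) \<in> R") blast+
qed

section \<open>The lexicographic order on monomials\<close>

lemma lex_less_irrefl [simp]: "\<not> lex_less R s s"
  by (simp add: lex_less_def)

text \<open>The higher of the two deciding variables decides the comparison of \<open>s\<close> with
  \<open>u\<close>.\<close>

lemma lex_less_trans:
  assumes R: "linear_order R" and "lex_less R s t" "lex_less R t u"
  shows "lex_less R s u"
proof -
  from assms(2) obtain v where v: "lookup s v < lookup t v"
    "\<And>w. w \<noteq> v \<Longrightarrow> (v, w) \<in> R \<Longrightarrow> lookup s w = lookup t w"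
    unfolding lex_less_def by blast
  from assms(3) obtain v' where v': "lookup t v' < lookup u v'"
    "\<And>w. w \<noteq> v' \<Longrightarrow> (v', w) \<in> R \<Longrightarrow> lookup t w = lookup u w"
    unfolding lex_less_def by blast
  note l = linear_orderD[OF R]
  show ?thesis
  proof (cases "(v, v') \<in> R")
    case True
    have "lookup s v' < lookup u v'"
      using v(1) v(2)[of v'] v'(1) True by (cases "v = v'") auto
    moreover have "lookup s w = lookup u w" if "w \<noteq> v'" "(v', w) \<in> R" for w
      using that v(2)[of w] v'(2)[of w] l(2)[of v v'] l(3)[of v v' w] True by auto
    ultimately show ?thesis unfolding lex_less_def by blast
  next
    case False
    then have F: "(v', v) \<in> R" "v \<noteq> v'" using l by blast+
    have "lookup s v < lookup u v"
      using v(1) v'(2)[OF F(2,1)] by simp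
    moreover have "lookup s w = lookup u w" if "w \<noteq> v" "(v, w) \<in> R" for w
      using that v(2)[of w] v'(2)[of w] l(2)[of v' v] l(3)[of v' v w] F by auto
    ultimately show ?thesis unfolding lex_less_def by blast
  qed
qed

text \<open>Monomials have finite support, so among the variables where two of them differ there is
  a highest one.\<close>

lemma lex_less_total:
  assumes R: "linear_order R" and "s \<noteq> t"
  shows "lex_less R s t \<or> lex_less R t s"
proof -
  let ?D = "{v. lookup s v \<noteq> lookup t v}"
  have "?D \<subseteq> keys s \<union> keys t" by (auto simp: in_keys_iff)
  then have "finite ?D" using finite_subset finite_keys by blast
  moreover have "?D \<noteq> {}" using assms(2) by (auto intro: poly_mapping_eqI)
  ultimately obtain v where v: "v \<in> ?D" "\<And>w. w \<in> ?D \<Longrightarrow> (w, v) \<in> R"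
    using finite_linear_order_max[OF R] by meson
  have "lookup s w = lookup t w" if "w \<noteq> v" "(v, w) \<in> R" for w
    using that v(2)[of w] linear_orderD(2)[OF R] by blast
  with v(1) show ?thesis unfolding lex_less_def
    by (cases "lookup s v < lookup t v") (auto simp: not_less le_less)
qed

lemma lex_less_add_right: "lex_less R s t \<Longrightarrow> lex_less R (s + u) (t + u)"
  unfolding lex_less_def by (auto simp: lookup_add)

lemma lex_less_add:
  assumes "linear_order R" "s = s' \<or> lex_less R s s'" "t = t' \<or> lex_less R t t'"
    "s \<noteq> s' \<or> t \<noteq> t'"
  shows "lex_less R (s + t) (s' + t')"
  using assms(2-4) lex_less_add_right[of R s s' t] lex_less_add_right[of R t t' s']
    lex_less_trans[OF assms(1), of "s + t" "s' + t" "s' + t'"]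
  by (auto simp: add.commute)

lemma lex_less_zero:
  assumes R: "linear_order R" and "m \<noteq> 0"
  shows "lex_less R 0 m"
  using lex_less_total[OF assms] unfolding lex_less_def by auto

lemma is_lex_max_exists:
  assumes R: "linear_order R" and "finite M" "M \<noteq> {}"
  shows "\<exists>m. is_lex_max R M m"
  using assms(2,3)
proof (induction rule: finite_ne_induct)
  case (singleton x)
  then show ?case by (auto simp: is_lex_max_def)
next
  case (insert x F)
  then obtain m where m: "is_lex_max R F m" by blast
  show ?case
  proof (cases "lex_less R m x")
    case True
    with m have "is_lex_max R (insert x F) x"
      using lex_less_trans[OF R, of _ m x] unfolding is_lex_max_def by auto
    then show ?thesis by blast
  next
    case False
    with m have "is_lex_max R (insert x F) m"
      using lex_less_total[OF R, of x m] unfolding is_lex_max_def by blast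
    then show ?thesis by blast
  qed
qed

section \<open>Products and leading monomials\<close>

text \<open>\<open>m\<close> and \<open>n\<close> form the only pair of monomials from the two
  supports with sum \<open>m + n\<close>, so the convolution sum for this coefficient has a single
  term.\<close>

lemma lookup_mult_lex_max:
  fixes f g :: "('v, 'k::field) pol"
  assumes R: "linear_order R" and m: "is_lex_max R (keys f) m" and n: "is_lex_max R (keys g) n"
  shows "lookup (f * g) (m + n) = lookup f m * lookup g n"
proof -
  have uniq: "s = m \<and> t = n" if "s \<in> keys f" "t \<in> keys g" "m + n = s + t" for s t
    using that m n lex_less_add[OF R, of s m t n] unfolding is_lex_max_def by auto
  have "Sum_any (\<lambda>q. lookup g q when m + n = l + q) = (lookup g n when l = m)" if l: "l \<in> keys f" for l
  proof -
    have "(lookup g q when m + n = l + q) = ((lookup g n when l = m) when q = n)" for q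
      using uniq[OF l, of q] by (cases "q \<in> keys g") (auto simp: when_def in_keys_iff)
    then show ?thesis by simp
  qed
  then have "lookup f l * Sum_any (\<lambda>q. lookup g q when m + n = l + q) = (lookup f m * lookup g n when l = m)"
    for l
    by (cases "l \<in> keys f") (auto simp: when_def in_keys_iff)
  then show ?thesis by (simp add: lookup_mult)
qed

lemma is_lex_max_mult:
  fixes f g :: "('v, 'k::field) pol"
  assumes R: "linear_order R" and m: "is_lex_max R (keys f) m" and n: "is_lex_max R (keys g) n"
  shows "is_lex_max R (keys (f * g)) (m + n)"
proof -
  have "m + n \<in> keys (f * g)"
    using m n lookup_mult_lex_max[OF assms] by (simp add: is_lex_max_def in_keys_iff)
  moreover have "lex_less R k (m + n)" if k: "k \<in> keys (f * g)" "k \<noteq> m + n" for k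
  proof -
    obtain s t where "k = s + t" "s \<in> keys f" "t \<in> keys g"
      using k(1) keys_mult[of f g] by blast
    then show ?thesis using m n k(2) lex_less_add[OF R, of s m t n]
      unfolding is_lex_max_def by auto
  qed
  ultimately show ?thesis by (auto simp: is_lex_max_def)
qed

text \<open>The product of two nonzero polynomials has a leading monomial. The variables carry no
  order here, so one is taken from the well-ordering theorem.\<close>

lemma pol_mult_eq_0_iff:
  fixes f g :: "('v, 'k::field) pol"
  shows "f * g = 0 \<longleftrightarrow> f = 0 \<or> g = 0"
proof -
  obtain R :: "'v rel" where "well_order_on UNIV R"
    using well_order_on by blast
  then have R: "linear_order R" by (simp add: well_order_on_def)
  have "f * g \<noteq> 0" if f: "f \<noteq> 0" and g: "g \<noteq> 0"
  proof -
    obtain m where "is_lex_max R (keys f) m"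
      using f is_lex_max_exists[OF R, of "keys f"] by auto
    moreover obtain n where "is_lex_max R (keys g) n"
      using g is_lex_max_exists[OF R, of "keys g"] by auto
    ultimately have "is_lex_max R (keys (f * g)) (m + n)"
      by (rule is_lex_max_mult[OF R])
    then show ?thesis by (auto simp: is_lex_max_def)
  qed
  then show ?thesis by auto
qed

lemma pol_mult_left_cancel:
  fixes f g h :: "('v, 'k::field) pol"
  assumes "h \<noteq> 0"
  shows "h * f = h * g \<longleftrightarrow> f = g"
  using assms pol_mult_eq_0_iff[of h "f - g"] by (auto simp: right_diff_distrib)


section \<open>Polynomials in one distinguished variable\<close>

text \<open>Unlike \<open>deg_in x f < n\<close>, this holds for \<open>f = 0\<close> and \<open>n = 0\<close>.\<close>

definition deg_below :: "'v \<Rightarrow> nat \<Rightarrow> ('v, 'k::zero) pol \<Rightarrow> bool" where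
  "deg_below x n f \<longleftrightarrow> (\<forall>m\<in>keys f. lookup m x < n)"

abbreviation xpow :: "'v \<Rightarrow> nat \<Rightarrow> ('v, 'k::zero_neq_one) pol" where
  "xpow x n \<equiv> single (single x n) 1"

text \<open>Taken at the leader of \<open>f\<close>, this is the initial of
  \<open>f\<close>.\<close>

abbreviation lc :: "'v \<Rightarrow> ('v, 'k::comm_monoid_add) pol \<Rightarrow> ('v, 'k) pol" where
  "lc x f \<equiv> coeff_in x (deg_in x f) f"

lemma finite_vars [simp]: "finite (vars f)"
  by (simp add: vars_def)

lemma in_vars_iff: "x \<in> vars f \<longleftrightarrow> (\<exists>m\<in>keys f. lookup m x \<noteq> 0)"
  by (auto simp: vars_def in_keys_iff)

lemma vars_zero [simp]: "vars 0 = {}"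
  by (simp add: vars_def)

lemma vars_one [simp]: "vars 1 = {}"
  by (simp add: vars_def)

lemma keys_minus_subset: "keys (f - g) \<subseteq> keys f \<union> keys (g :: 'a \<Rightarrow>\<^sub>0 'b::ab_group_add)"
  by (auto simp: in_keys_iff lookup_minus)

lemma vars_minus_subset:
  fixes f g :: "('v, 'k::field) pol"
  shows "vars (f - g) \<subseteq> vars f \<union> vars g"
  using keys_minus_subset[of f g] by (auto simp: vars_def)

lemma vars_mult_subset: "vars (f * g) \<subseteq> vars f \<union> vars g"
  using keys_mult[of f g] keys_add by (fastforce simp: vars_def)

lemma vars_xpow_subset: "vars (xpow x n :: ('v, 'k::field) pol) \<subseteq> {x}"
  by (simp add: vars_def)

lemma lookup_le_deg_in: "m \<in> keys f \<Longrightarrow> lookup m x \<le> deg_in x f"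
  unfolding deg_in_def by (rule Max_ge) auto

lemma deg_in_eqI:
  assumes "m \<in> keys f" "lookup m x = n" "\<And>m. m \<in> keys f \<Longrightarrow> lookup m x \<le> n"
  shows "deg_in x f = n"
  unfolding deg_in_def using assms by (intro Max_eqI) auto

lemma deg_in_attained:
  assumes "f \<noteq> 0"
  shows "\<exists>m\<in>keys f. lookup m x = deg_in x f"
proof -
  have "deg_in x f \<in> insert 0 ((\<lambda>m. lookup m x) ` keys f)"
    unfolding deg_in_def by (rule Max_in) auto
  moreover obtain m where "m \<in> keys f" using assms by (metis all_not_in_conv keys_empty_iff)
  ultimately show ?thesis using lookup_le_deg_in[of m f x] by auto
qed

lemma deg_in_less_iff: "0 < n \<Longrightarrow> deg_in x f < n \<longleftrightarrow> deg_below x n f"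
  unfolding deg_in_def deg_below_def by (subst Max_less_iff) auto

lemma deg_in_eq_0_iff: "deg_in x f = 0 \<longleftrightarrow> x \<notin> vars f"
  using deg_in_less_iff[of 1 x f] by (auto simp: deg_below_def in_vars_iff)

lemma deg_below_minus:
  fixes f g :: "('v, 'k::field) pol"
  shows "deg_below x n f \<Longrightarrow> deg_below x n g \<Longrightarrow> deg_below x n (f - g)"
  using keys_minus_subset[of f g] unfolding deg_below_def by blast

lemma deg_below_add: "deg_below x n f \<Longrightarrow> deg_below x n g \<Longrightarrow> deg_below x n (f + g)"
  using keys_add[of f g] unfolding deg_below_def by blast

lemma deg_below_mult:
  assumes "deg_in x f \<le> i" "deg_below x j g"
  shows "deg_below x (i + j) (f * g)"
  unfolding deg_below_def
proof
  fix k assume "k \<in> keys (f * g)"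
  then obtain s t where "k = s + t" "s \<in> keys f" "t \<in> keys g"
    using keys_mult[of f g] by blast
  then show "lookup k x < i + j"
    using assms lookup_le_deg_in[of s f x] by (fastforce simp: deg_below_def lookup_add)
qed

section \<open>Coefficients and leading terms\<close>

lemma lookup_mult_single:
  fixes f :: "('v, 'k::field) pol"
  shows "lookup (f * single s 1) (m + s) = lookup f m"
proof -
  have "Sum_any (\<lambda>q. lookup (single s 1) q when m + s = l + q) = ((1::'k) when l = m)" for l
  proof -
    have "(lookup (single s (1::'k)) q when m + s = l + q) = ((1 when l = m) when q = s)" for q
      by (auto simp: lookup_single when_def)
    then show ?thesis by simp
  qed
  then show ?thesis by (simp add: lookup_mult mult_when)
qed

lemma keys_mult_single:
  fixes f :: "('v, 'k::field) pol"
  shows "keys (f * single s 1) = (\<lambda>m. m + s) ` keys f"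
proof -
  have "keys (f * single s 1) \<subseteq> (\<lambda>m. m + s) ` keys f"
    using keys_mult[of f "single s 1"] by auto
  then show ?thesis by (auto simp: in_keys_iff lookup_mult_single)
qed

lemma lookup_coeff_in:
  "lookup (coeff_in x d f) m = (if lookup m x = 0 then lookup f (m + single x d) else 0)"
proof -
  \<comment> \<open>As \<open>k\<close> has exponent \<open>d\<close> at \<open>x\<close>, the
    subtraction is not truncated and can be undone by adding \<open>single x d\<close>.\<close>
  have eq: "k - single x d = m \<longleftrightarrow> lookup m x = 0 \<and> k = m + single x d" if "lookup k x = d" for k
  proof
    assume m: "k - single x d = m"
    have "k = m + single x d"
      by (rule poly_mapping_eqI)
        (use that in \<open>auto simp: m[symmetric] lookup_add lookup_minus lookup_single when_def\<close>)
    then show "lookup m x = 0 \<and> k = m + single x d"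
      using that by (simp add: lookup_add)
  qed auto
  have "lookup (coeff_in x d f) m =
      (\<Sum>k | k \<in> keys f \<and> lookup k x = d. lookup f k when k - single x d = m)"
    by (simp add: coeff_in_def lookup_sum lookup_single)
  also have "\<dots> = (\<Sum>k | k \<in> keys f \<and> lookup k x = d.
      if k = m + single x d then (lookup f k when lookup m x = 0) else 0)"
    by (rule sum.cong) (auto simp: eq when_def)
  also have "\<dots> = (if lookup m x = 0 then lookup f (m + single x d) else 0)"
    by (subst sum.delta) (auto simp: lookup_add in_keys_iff)
  finally show ?thesis .
qed

lemma notin_vars_coeff_in: "x \<notin> vars (coeff_in x d f)"
  by (auto simp: in_vars_iff in_keys_iff lookup_coeff_in split: if_splits)

lemma vars_coeff_in_subset: "vars (coeff_in x d f) \<subseteq> vars f"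
proof
  fix v assume "v \<in> vars (coeff_in x d f)"
  then obtain m where "m + single x d \<in> keys f" "lookup m v \<noteq> 0"
    by (auto simp: in_vars_iff in_keys_iff lookup_coeff_in split: if_splits)
  then show "v \<in> vars f"
    unfolding in_vars_iff by (intro bexI[of _ "m + single x d"]) (simp_all add: lookup_add)
qed

lemma lc_nonzero:
  assumes "f \<noteq> 0"
  shows "lc x f \<noteq> 0"
proof -
  obtain m where m: "m \<in> keys f" "lookup m x = deg_in x f"
    using deg_in_attained[OF assms] by blast
  have "m - single x (deg_in x f) + single x (deg_in x f) = m"
    by (rule poly_mapping_eqI) (use m in \<open>auto simp: lookup_add lookup_minus lookup_single when_def\<close>)
  then have "lookup (lc x f) (m - single x (deg_in x f)) \<noteq> 0"
    using m by (simp add: lookup_coeff_in lookup_minus in_keys_iff)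
  then show ?thesis by (metis lookup_zero)
qed

text \<open>The monomials of the first summand have exponent exactly \<open>n\<close> at
  \<open>x\<close> and those of \<open>r\<close> a smaller one, so nothing cancels. For
  \<open>n = 0\<close> the bound on \<open>r\<close> forces \<open>r = 0\<close>.\<close>

lemma deg_in_lead:
  fixes l r :: "('v, 'k::field) pol"
  assumes l: "l \<noteq> 0" and x: "x \<notin> vars l" and r: "deg_below x n r"
  shows "deg_in x (l * xpow x n + r) = n"
proof -
  obtain m where m: "m \<in> keys l" using l keys_empty_iff[of l] by blast
  have xl: "\<forall>m\<in>keys l. lookup m x = 0" using x by (simp add: in_vars_iff)
  have mx: "lookup (m + single x n) x = n" using m xl by (simp add: lookup_add)
  have "m + single x n \<notin> keys r" using r mx unfolding deg_below_def by (metis less_irrefl)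
  then have "lookup r (m + single x n) = 0" by (simp add: in_keys_iff)
  then have k: "m + single x n \<in> keys (l * xpow x n + r)"
    using m by (simp only: in_keys_iff lookup_add[of "l * xpow x n"] lookup_mult_single add_0_right not_False_eq_True)
  have "lookup k x \<le> n" if "k \<in> keys (l * xpow x n + r)" for k
  proof -
    have "k \<in> keys (l * xpow x n) \<union> keys r" by (rule subsetD[OF keys_add that])
    then show ?thesis
    proof
      assume "k \<in> keys (l * xpow x n)"
      then obtain m' where "m' \<in> keys l" "k = m' + single x n"
        unfolding keys_mult_single by blast
      then show ?thesis using xl by (simp add: lookup_add)
    next
      assume "k \<in> keys r"
      then show ?thesis using r unfolding deg_below_def by (blast intro: less_imp_le)
    qed
  qed
  then show ?thesis by (rule deg_in_eqI[OF k mx])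
qed

lemma coeff_in_lead:
  fixes l r :: "('v, 'k::field) pol"
  assumes "x \<notin> vars l" "deg_below x n r"
  shows "coeff_in x n (l * xpow x n + r) = l"
proof (rule poly_mapping_eqI)
  fix m
  have "lookup r (m + single x n) = 0"
    if "lookup m x = 0"
    using assms(2) that unfolding deg_below_def
    by (metis add_0 in_keys_iff less_irrefl lookup_add lookup_single_eq)
  moreover have "lookup l m = 0" if "lookup m x \<noteq> 0"
    using that assms(1) unfolding in_vars_iff by (metis in_keys_iff)
  ultimately show "lookup (coeff_in x n (l * xpow x n + r)) m = lookup l m"
    by (simp add: lookup_coeff_in lookup_add[of "l * xpow x n"] lookup_mult_single)
qed

definition lead_rest :: "'v \<Rightarrow> ('v, 'k::field) pol \<Rightarrow> ('v, 'k) pol" where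
  "lead_rest x f = f - lc x f * xpow x (deg_in x f)"

lemma lead_decomp: "f = lc x f * xpow x (deg_in x f) + lead_rest x f"
  by (simp add: lead_rest_def)

text \<open>At exponent \<open>deg_in x f\<close> of \<open>x\<close>, the coefficients of
  \<open>f\<close> and of its leading term agree.\<close>

lemma deg_below_lead_rest: "deg_below x (deg_in x f) (lead_rest x f)"
  unfolding deg_below_def
proof
  let ?n = "deg_in x f"
  fix m assume m: "m \<in> keys (lead_rest x f)"
  then have "m \<in> keys f \<or> m \<in> keys (lc x f * xpow x ?n)"
    using keys_minus_subset[of f "lc x f * xpow x ?n"] unfolding lead_rest_def by blast
  then have le: "lookup m x \<le> ?n"
    using notin_vars_coeff_in[of x ?n f]
    by (auto simp: lookup_le_deg_in keys_mult_single lookup_add in_vars_iff)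
  show "lookup m x < ?n"
  proof (rule ccontr)
    assume "\<not> lookup m x < ?n"
    with le have n: "lookup m x = ?n" by simp
    define m' where "m' = m - single x ?n"
    have m': "m = m' + single x ?n"
      by (rule poly_mapping_eqI)
        (use n in \<open>auto simp: m'_def lookup_add lookup_minus lookup_single when_def\<close>)
    with n have "lookup m' x = 0" by (simp add: lookup_add)
    then have "lookup (lc x f * xpow x ?n) m = lookup f m"
      by (simp add: m' lookup_mult_single lookup_coeff_in)
    then show False using m by (simp add: lead_rest_def in_keys_iff lookup_minus)
  qed
qed

lemma vars_lead_rest_subset: "vars (lead_rest x f) \<subseteq> vars f"
proof (cases "x \<in> vars f")
  case True
  have "vars (lc x f * xpow x (deg_in x f)) \<subseteq> vars f"
    using vars_mult_subset[of "lc x f" "xpow x (deg_in x f)"] vars_xpow_subset[of x "deg_in x f"]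
      vars_coeff_in_subset[of x "deg_in x f" f] True by blast
  then show ?thesis
    using vars_minus_subset[of f "lc x f * xpow x (deg_in x f)"] unfolding lead_rest_def by blast
next
  case False
  \<comment> \<open>Degree 0 turns the bound into \<open>deg_below x 0\<close>, which leaves no
    monomial.\<close>
  then have "deg_below x 0 (lead_rest x f)"
    using deg_below_lead_rest[of x f] deg_in_eq_0_iff[of x f] by simp
  then have "keys (lead_rest x f) = {}" by (auto simp: deg_below_def)
  then have "lead_rest x f = 0" by simp
  then show ?thesis by simp
qed

text \<open>Multiplying out the decompositions leaves the product of the two leading terms plus
  terms of lower degree in \<open>x\<close>. The product of the leading coefficients is nonzero and
  free of \<open>x\<close>, so \<open>deg_in_lead\<close> and \<open>coeff_in_lead\<close>
  apply.\<close>

lemma lc_mult_deg_in_mult: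
  fixes f g :: "('v, 'k::field) pol"
  assumes "f \<noteq> 0" "g \<noteq> 0"
  shows deg_in_mult: "deg_in x (f * g) = deg_in x f + deg_in x g"
    and lc_mult: "lc x (f * g) = lc x f * lc x g"
proof -
  let ?n = "deg_in x f" and ?m = "deg_in x g"
  let ?r = "lc x f * xpow x ?n * lead_rest x g + lead_rest x f * g"
  have "f * g = (lc x f * xpow x ?n + lead_rest x f) * g"
    by (rule arg_cong[OF lead_decomp, of "\<lambda>h. h * g"])
  also have "\<dots> = lc x f * xpow x ?n * g + lead_rest x f * g"
    by (rule distrib_right)
  also have "lc x f * xpow x ?n * g =
      lc x f * xpow x ?n * (lc x g * xpow x ?m + lead_rest x g)"
    by (rule arg_cong[OF lead_decomp, of "\<lambda>h. lc x f * xpow x ?n * h"])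
  also have "lc x f * xpow x ?n * (lc x g * xpow x ?m + lead_rest x g) + lead_rest x f * g =
      (lc x f * lc x g) * (xpow x ?n * xpow x ?m) + ?r"
    by (simp add: algebra_simps)
  finally have eq: "f * g = (lc x f * lc x g) * xpow x (?n + ?m) + ?r"
    by (simp add: mult_single single_add)
  have "deg_in x (lc x f * xpow x ?n + 0) = ?n"
    by (rule deg_in_lead) (auto simp: assms lc_nonzero notin_vars_coeff_in deg_below_def)
  then have "deg_below x (?n + ?m) (lc x f * xpow x ?n * lead_rest x g)"
    by (intro deg_below_mult) (auto simp: deg_below_lead_rest)
  moreover have "deg_below x (?n + ?m) (lead_rest x f * g)"
    using deg_below_mult[of x g ?m ?n "lead_rest x f"] deg_below_lead_rest[of x f]
    by (simp add: mult.commute add.commute)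
  ultimately have r: "deg_below x (?n + ?m) ?r" by (rule deg_below_add)
  have v: "x \<notin> vars (lc x f * lc x g)"
    using vars_mult_subset[of "lc x f" "lc x g"] notin_vars_coeff_in[of x] by blast
  show "deg_in x (f * g) = ?n + ?m"
    unfolding eq by (rule deg_in_lead[OF _ v r]) (simp add: pol_mult_eq_0_iff lc_nonzero assms)
  then show "lc x (f * g) = lc x f * lc x g"
    using coeff_in_lead[OF v r] eq by simp
qed

lemma vars_mult:
  fixes f g :: "('v, 'k::field) pol"
  assumes "f \<noteq> 0" "g \<noteq> 0"
  shows "vars (f * g) = vars f \<union> vars g"
proof -
  have "v \<in> vars (f * g) \<longleftrightarrow> v \<in> vars f \<union> vars g" for v
    using deg_in_mult[OF assms, of v] deg_in_eq_0_iff[of v] by (metis Un_iff add_is_0)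
  then show ?thesis by blast
qed

lemma vars_dvd_subset:
  fixes f g :: "('v, 'k::field) pol"
  assumes "f dvd g" "g \<noteq> 0"
  shows "vars f \<subseteq> vars g"
proof -
  obtain h where h: "g = f * h" using assms(1) by (rule dvdE)
  then have "f \<noteq> 0" "h \<noteq> 0" using assms(2) by auto
  then show ?thesis using vars_mult[of f h] h by blast
qed

lemma lc_eq_self:
  fixes f :: "('v, 'k::field) pol"
  assumes "x \<notin> vars f"
  shows "lc x f = f"
  using assms coeff_in_lead[of x f 0 0] deg_in_eq_0_iff[of x f] by (simp add: deg_below_def)


section \<open>Irreducible polynomials are prime\<close>

text \<open>The sum of the partial degrees is additive on products of nonzero polynomials and 0
  exactly on constants, hence a measure for inductions on factorizations.\<close>

definition total_size :: "('v, 'k::zero) pol \<Rightarrow> nat" where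
  "total_size f = (\<Sum>v\<in>vars f. deg_in v f)"

lemma total_size_mult:
  fixes f g :: "('v, 'k::field) pol"
  assumes "f \<noteq> 0" "g \<noteq> 0"
  shows "total_size (f * g) = total_size f + total_size g"
proof -
  have sup: "total_size h = (\<Sum>v\<in>vars f \<union> vars g. deg_in v h)"
    if "vars h \<subseteq> vars f \<union> vars g" for h :: "('v, 'k) pol"
    unfolding total_size_def
    by (rule sum.mono_neutral_left) (use that in \<open>auto simp: deg_in_eq_0_iff\<close>)
  have "total_size (f * g) = (\<Sum>v\<in>vars f \<union> vars g. deg_in v (f * g))"
    by (rule sup) (simp add: vars_mult[OF assms])
  also have "\<dots> = (\<Sum>v\<in>vars f \<union> vars g. deg_in v f + deg_in v g)"
    by (simp add: deg_in_mult[OF assms])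
  also have "\<dots> = total_size f + total_size g"
    by (simp add: sum.distrib sup)
  finally show ?thesis .
qed

lemma vars_empty_iff: "vars f = {} \<longleftrightarrow> f \<in> range Const"
proof
  assume v: "vars f = {}"
  have "f = Const (lookup f 0)"
  proof (rule poly_mapping_eqI)
    fix m show "lookup f m = lookup (Const (lookup f 0)) m"
    proof (cases "m = 0")
      case False
      then have "keys m \<noteq> {}" by simp
      then have "m \<notin> keys f" using v by (auto simp: vars_def)
      then show ?thesis using False by (simp add: Const_def lookup_single in_keys_iff)
    qed (simp add: Const_def)
  qed
  then show "f \<in> range Const" by blast
qed (auto simp: Const_def vars_def split: if_splits)

lemma Const_0 [simp]: "Const 0 = 0"
  by (simp add: Const_def)

lemma Const_dvd_1:
  assumes "c \<noteq> (0::'k::field)"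
  shows "Const c dvd (1 :: ('v, 'k) pol)"
proof
  show "1 = Const c * (Const (inverse c) :: ('v, 'k) pol)"
    using assms by (simp add: Const_def mult_single)
qed

text \<open>The variables of a product of nonzero polynomials are those of the two factors together,
  so a unit has none.\<close>

lemma pol_dvd_1_iff:
  fixes f :: "('v, 'k::field) pol"
  shows "f dvd 1 \<longleftrightarrow> f \<noteq> 0 \<and> vars f = {}"
proof
  assume "f dvd 1"
  then obtain g where g: "1 = f * g" by (rule dvdE)
  then have "f * g \<noteq> 0" by (metis zero_neq_one)
  then have "f \<noteq> 0" "g \<noteq> 0" by auto
  then show "f \<noteq> 0 \<and> vars f = {}" using vars_mult[of f g] g by (metis Un_empty vars_one)
next
  assume "f \<noteq> 0 \<and> vars f = {}"
  then obtain c where c: "f = Const c" "f \<noteq> 0" by (auto simp: vars_empty_iff)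
  then have "c \<noteq> 0" by auto
  then show "f dvd 1" unfolding c(1) by (rule Const_dvd_1)
qed

lemma total_size_eq_0_iff: "total_size f = 0 \<longleftrightarrow> vars f = {}"
  by (auto simp: total_size_def deg_in_eq_0_iff)

text \<open>Descent on \<open>total_size\<close>: both factors of a nontrivial factorization are
  nonconstant, so each is smaller than \<open>f\<close>.\<close>

lemma irreducible_divisor_exists:
  fixes f :: "('v, 'k::field) pol"
  assumes "f \<noteq> 0" "\<not> f dvd 1"
  shows "\<exists>p. irreducible p \<and> p dvd f"
  using assms
proof (induction "total_size f" arbitrary: f rule: less_induct)
  case less
  show ?case
  proof (cases "irreducible f")
    case False
    then obtain a b where ab: "f = a * b" "\<not> a dvd 1" "\<not> b dvd 1"
      using less.prems unfolding irreducible_def by blast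
    then have "a \<noteq> 0" "b \<noteq> 0" using less.prems by auto
    then have "total_size a < total_size f"
      using ab total_size_mult[of a b] total_size_eq_0_iff[of b] pol_dvd_1_iff[of b] by simp
    then obtain p where "irreducible p" "p dvd a"
      using less.hyps \<open>a \<noteq> 0\<close> ab(2) by blast
    then show ?thesis using ab(1) by (meson dvd_mult2)
  qed auto
qed

section \<open>Primality relative to a set of variables\<close>

text \<open>Bounding the variables of the two factors by \<open>W\<close> permits induction on
  \<open>W\<close>; divisibility itself is that of the full ring.\<close>

definition prime_within :: "'v set \<Rightarrow> ('v, 'k::field) pol \<Rightarrow> bool" where
  "prime_within W p \<longleftrightarrow>
     (\<forall>a b. vars a \<subseteq> W \<longrightarrow> vars b \<subseteq> W \<longrightarrow> p dvd a * b \<longrightarrow> p dvd a \<or> p dvd b)"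

text \<open>The irreducible factors of \<open>q\<close> can be removed one at a time: being prime
  within \<open>W\<close>, each divides \<open>a\<close> or \<open>b\<close> and is cancelled there.
  What is left of \<open>a\<close> and \<open>b\<close> multiplies to \<open>p\<close>, up to a
  unit.\<close>

lemma refine_factorization:
  fixes p q a b :: "('v, 'k::field) pol"
  assumes "\<And>r. irreducible r \<Longrightarrow> r dvd q \<Longrightarrow> prime_within W r"
    and "p * q = a * b" "p \<noteq> 0" "q \<noteq> 0" "vars a \<subseteq> W" "vars b \<subseteq> W"
  shows "\<exists>a' b'. a' dvd a \<and> b' dvd b \<and> p = a' * b'"
  using assms
proof (induction "total_size q" arbitrary: q a b rule: less_induct)
  case less
  have ab0: "a * b \<noteq> 0" using less.prems pol_mult_eq_0_iff[of p q] by simp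
  then have a0: "a \<noteq> 0" and b0: "b \<noteq> 0" by auto
  show ?case
  proof (cases "q dvd 1")
    case True
    then obtain u where u: "1 = q * u" by (rule dvdE)
    \<comment> \<open>A unit \<open>q\<close> is absorbed into the second factor:
      \<open>a' = a\<close> and \<open>b' = b * u\<close>.\<close>
    have "p = a * (b * u)"
      using less.prems(2) u by (metis mult.assoc mult.right_neutral)
    moreover have "b = b * u * q" using u by (metis mult.assoc mult.commute mult.right_neutral)
    then have "b * u dvd b" by (rule dvdI)
    ultimately show ?thesis using dvd_refl[of a] by metis
  next
    case False
    then obtain r where r: "irreducible r" "r dvd q"
      using irreducible_divisor_exists less.prems(4) by blast
    then obtain q' where q': "q = r * q'" by (meson dvdE)
    have r0: "r \<noteq> 0" and q'0: "q' \<noteq> 0" using q' less.prems(4) by auto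
    have size: "total_size q' < total_size q"
      using total_size_mult[OF r0 q'0] q' r(1) total_size_eq_0_iff[of r] pol_dvd_1_iff[of r] r0
      by (simp add: irreducible_def)
    have primes: "prime_within W s" if "irreducible s" "s dvd q'" for s
      using less.prems(1) that q' by (meson dvd_mult)
    have eq: "r * (p * q') = a * b" using less.prems(2) q' by (simp add: ac_simps)
    then have "r dvd a * b" by (metis dvd_triv_left)
    then have "r dvd a \<or> r dvd b"
      using less.prems(1)[OF r] less.prems(5,6) unfolding prime_within_def by blast
    then show ?thesis
    proof
      assume "r dvd a"
      then obtain a1 where a1: "a = r * a1" by (rule dvdE)
      then have "p * q' = a1 * b"
        using eq pol_mult_left_cancel[OF r0, of "p * q'" "a1 * b"] by (simp add: mult.assoc)
      moreover have "vars a1 \<subseteq> W"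
        using vars_dvd_subset[of a1 a] a1 a0 less.prems(5) by auto
      ultimately obtain a' b' where "a' dvd a1" "b' dvd b" "p = a' * b'"
        using less.hyps[OF size primes _ less.prems(3) q'0 _ less.prems(6)] by blast
      moreover from this(1) have "a' dvd a" unfolding a1 by (rule dvd_mult)
      ultimately show ?thesis by blast
    next
      assume "r dvd b"
      then obtain b1 where b1: "b = r * b1" by (rule dvdE)
      then have "p * q' = a * b1"
        using eq pol_mult_left_cancel[OF r0, of "p * q'" "a * b1"] by (simp add: ac_simps)
      moreover have "vars b1 \<subseteq> W"
        using vars_dvd_subset[of b1 b] b1 b0 less.prems(6) by auto
      ultimately obtain a' b' where "a' dvd a" "b' dvd b1" "p = a' * b'"
        using less.hyps[OF size primes _ less.prems(3) q'0 less.prems(5)] by blast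
      moreover from this(2) have "b' dvd b" unfolding b1 by (rule dvd_mult)
      ultimately show ?thesis by blast
    qed
  qed
qed

text \<open>Gauss's lemma: by induction on the degrees, the leading terms divisible by \<open>p\<close> can be
  stripped off.\<close>

lemma prime_within_insert:
  fixes p :: "('v, 'k::field) pol"
  assumes p: "prime_within V p" "x \<notin> vars p" and p0: "p \<noteq> 0"
  shows "prime_within (insert x V) p"
proof -
  have "p dvd a \<or> p dvd b"
    if "vars a \<subseteq> insert x V" "vars b \<subseteq> insert x V" "p dvd a * b" for a b
    using that
  proof (induction "deg_in x a + deg_in x b" arbitrary: a b rule: less_induct)
    case less
    show ?case
    proof (cases "a = 0 \<or> b = 0")
      case False
      then have ab0: "a \<noteq> 0" "b \<noteq> 0" by auto
      obtain q where q: "a * b = p * q" using less.prems(3) by (rule dvdE)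
      then have q0: "q \<noteq> 0" using ab0 pol_mult_eq_0_iff[of a b] by auto
      \<comment> \<open>Stated for \<open>a'\<close> and \<open>b'\<close> with the same degree sum,
        so that it serves both \<open>a, b\<close> and \<open>b, a\<close>. If \<open>x\<close>
        occurs in \<open>a'\<close>, passing to \<open>lead_rest x a'\<close> lowers that
        sum.\<close>
      have strip: "p dvd a' \<or> p dvd b'"
        if deg: "deg_in x a' + deg_in x b' = deg_in x a + deg_in x b"
          and va: "vars a' \<subseteq> insert x V" and vb: "vars b' \<subseteq> insert x V"
          and ab: "p dvd a' * b'" and lca: "p dvd lc x a'" for a' b'
      proof -
        let ?r = "lead_rest x a'"
        have lead: "p dvd lc x a' * xpow x (deg_in x a')" using lca by (rule dvd_mult2)
        have up: "p dvd a'" if "p dvd ?r"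
          using dvd_add[OF lead that] by (simp flip: lead_decomp)
        show ?thesis
        proof (cases "x \<in> vars a'")
          case False
          then show ?thesis using lca lc_eq_self[of x a'] by simp
        next
          case True
          then have "deg_in x ?r < deg_in x a'"
            using deg_in_less_iff[of "deg_in x a'" x ?r] deg_below_lead_rest[of x a']
              deg_in_eq_0_iff[of x a'] by simp
          moreover have "p dvd ?r * b'"
            unfolding lead_rest_def left_diff_distrib by (intro dvd_diff ab dvd_mult2 lead)
          ultimately have "p dvd ?r \<or> p dvd b'"
            using less.hyps[of ?r b'] deg va vb vars_lead_rest_subset[of x a'] by auto
          then show ?thesis using up by blast
        qed
      qed
      \<comment> \<open>As \<open>x\<close> does not occur in \<open>p\<close>, \<open>p\<close> is
        its own leading coefficient; the leading coefficients in \<open>a * b = p * q\<close> are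
        compared.\<close>
      have "lc x a * lc x b = p * lc x q"
        using lc_mult[OF ab0, of x] lc_mult[OF p0 q0, of x] q lc_eq_self[OF p(2)] by simp
      then have "p dvd lc x a * lc x b" by simp
      moreover have "vars (lc x a) \<subseteq> V" "vars (lc x b) \<subseteq> V"
        using vars_coeff_in_subset[of x _ a] vars_coeff_in_subset[of x _ b]
          notin_vars_coeff_in[of x _ a] notin_vars_coeff_in[of x _ b] less.prems(1,2) by blast+
      ultimately have "p dvd lc x a \<or> p dvd lc x b"
        using p(1) unfolding prime_within_def by blast
      then show ?thesis
        using strip[of a b] strip[of b a] less.prems by (auto simp: ac_simps)
    qed auto
  qed
  then show ?thesis by (simp add: prime_within_def)
qed

text \<open>The irreducible factors of \<open>c\<close> are prime within \<open>W\<close>, so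
  \<open>f * c = p * q\<close> can be refined to \<open>f = a * b\<close> with
  \<open>a dvd p\<close> and \<open>b dvd q\<close>. If \<open>a\<close> is associated to
  \<open>p\<close>, then \<open>p dvd f\<close>; if \<open>a\<close> is a unit, then
  \<open>p\<close> divides \<open>c * a\<close>, which has no variable outside \<open>V\<close>,
  while \<open>p\<close> has one.\<close>

lemma irreducible_dvd_cancel:
  fixes p :: "('v, 'k::field) pol"
  assumes primes: "\<And>r :: ('v, 'k) pol. irreducible r \<Longrightarrow> vars r \<subseteq> V \<Longrightarrow> prime_within W r"
    and p: "irreducible p" "\<not> vars p \<subseteq> V" "vars p \<subseteq> W"
    and c: "c \<noteq> 0" "vars c \<subseteq> V" and f: "vars f \<subseteq> W" and VW: "V \<subseteq> W"
    and dvd: "p dvd c * f"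
  shows "p dvd f"
proof (cases "f = 0")
  case False
  obtain q where q: "c * f = p * q" using dvd by (rule dvdE)
  have q0: "q \<noteq> 0" "p \<noteq> 0" using q False c(1) pol_mult_eq_0_iff[of c f] by auto
  have "vars p \<union> vars q = vars c \<union> vars f"
    using vars_mult[OF c(1) False] vars_mult[OF q0(2,1)] q by simp
  then have vq: "vars q \<subseteq> W" using c(2) f VW by blast
  have r: "prime_within W r" if "irreducible r" "r dvd c" for r
    using primes[OF that(1)] vars_dvd_subset[OF that(2) c(1)] c(2) by blast
  have "f * c = p * q" using q by (simp add: mult.commute)
  then obtain a b where ab: "a dvd p" "b dvd q" "f = a * b"
    using refine_factorization[OF r _ False c(1) p(3) vq] by blast
  obtain s where s: "p = a * s" using ab(1) by (rule dvdE)
  obtain t where t: "q = b * t" using ab(2) by (rule dvdE)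
  from p(1) s have "a dvd 1 \<or> s dvd 1" by (rule irreducibleD)
  then show ?thesis
  proof
    assume "s dvd 1"
    then obtain u where "1 = s * u" by (rule dvdE)
    then have "a = p * u" using s by (simp add: mult.assoc)
    then show ?thesis using ab(3) by (simp add: dvd_mult2)
  next
    assume a: "a dvd 1"
    have nz: "a \<noteq> 0" "b \<noteq> 0" "t \<noteq> 0" using ab(3) False t q0 by auto
    have "b * (c * a) = b * (p * t)" using q ab(3) t by (simp add: ac_simps)
    then have "c * a = p * t" using pol_mult_left_cancel[OF nz(2)] by blast
    then have "vars c \<union> vars a = vars p \<union> vars t"
      using vars_mult[OF c(1) nz(1)] vars_mult[OF q0(2) nz(3)] by simp
    then show ?thesis using a c(2) p(2) pol_dvd_1_iff[of a] by blast
  qed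
qed auto

lemma dvd_mult_unit_left:
  fixes a :: "'a::comm_semiring_1"
  assumes "a dvd 1" "b dvd c"
  shows "a * b dvd c"
  using mult_dvd_mono[OF assms] by simp

text \<open>The degree of \<open>p\<close> in the new variable \<open>x\<close> is lowered first, then those of the two factors of a
  multiple \<open>p * q = a * b\<close>. A factor of degree at least \<open>deg p\<close> is replaced by its pseudo-remainder;
  if both have smaller degree, then so has \<open>q\<close>, whose irreducible factors are prime already.\<close>

lemma prime_within_insert_new:
  fixes p :: "('v, 'k::field) pol"
  assumes IH: "\<And>r :: ('v, 'k) pol. irreducible r \<Longrightarrow> vars r \<subseteq> V \<Longrightarrow> prime_within V r"
    and x: "x \<notin> V" and p: "irreducible p" "vars p \<subseteq> insert x V"
  shows "prime_within (insert x V) p"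
  using p
proof (induction "deg_in x p" arbitrary: p rule: less_induct)
  case (less p)
  note outer = less.hyps
  let ?W = "insert x V"
  \<comment> \<open>Gauss's lemma carries primality from \<open>V\<close> over to
    \<open>insert x V\<close> for polynomials free of \<open>x\<close>.\<close>
  have free: "prime_within ?W r" if "irreducible r" "vars r \<subseteq> V" for r :: "('v, 'k) pol"
    using prime_within_insert[OF IH[OF that], of x] that x by (metis not_irreducible_zero subsetD)
  have p0: "p \<noteq> 0" using less.prems(1) by auto
  show ?case
  proof (cases "x \<in> vars p")
    case False
    then show ?thesis using free[of p] less.prems by blast
  next
    case True
    then have dp: "0 < deg_in x p" using deg_in_eq_0_iff[of x p] by simp
    have lcV: "vars (lc x f) \<subseteq> V" if "vars f \<subseteq> ?W" for f :: "('v, 'k) pol"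
      using vars_coeff_in_subset[of x _ f] notin_vars_coeff_in[of x _ f] that by blast
    have "p dvd a \<or> p dvd b" if "vars a \<subseteq> ?W" "vars b \<subseteq> ?W" "p dvd a * b" for a b
      using that
    proof (induction "deg_in x a + deg_in x b" arbitrary: a b rule: less_induct)
      case (less a b)
      note vars_p = \<open>vars p \<subseteq> ?W\<close> and irr = \<open>irreducible p\<close>
      show ?case
      proof (cases "a = 0 \<or> b = 0")
        case False
        then have ab0: "a \<noteq> 0" "b \<noteq> 0" by auto
        have reduce: "p dvd a' \<or> p dvd b'"
          if deg: "deg_in x a' + deg_in x b' = deg_in x a + deg_in x b"
            and va: "vars a' \<subseteq> ?W" and vb: "vars b' \<subseteq> ?W" and ab: "p dvd a' * b'"
            and a'0: "a' \<noteq> 0" and ge: "deg_in x p \<le> deg_in x a'" for a' b'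
        proof -
          let ?n = "deg_in x a'" and ?m = "deg_in x p"
          \<comment> \<open>One step of pseudo-division: multiplying \<open>a'\<close> by
            \<open>lc x p\<close> avoids dividing leading coefficients, and the leading terms in
            \<open>x\<close> cancel.\<close>
          define s where "s = lc x p * a' - lc x a' * xpow x (?n - ?m) * p"
          have pow: "xpow x ?n = xpow x (?n - ?m) * (xpow x ?m :: ('v, 'k) pol)"
            using ge by (simp add: mult_single flip: single_add)
          have "s = lc x p * (lc x a' * xpow x ?n + lead_rest x a')
              - lc x a' * xpow x (?n - ?m) * (lc x p * xpow x ?m + lead_rest x p)"
            unfolding s_def by (simp flip: lead_decomp)
          also have "\<dots> = lc x p * lead_rest x a' - lc x a' * xpow x (?n - ?m) * lead_rest x p"
            unfolding pow by (simp add: algebra_simps)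
          finally have s: "s = lc x p * lead_rest x a' - lc x a' * xpow x (?n - ?m) * lead_rest x p" .
          have "deg_below x (0 + ?n) (lc x p * lead_rest x a')"
            using deg_in_eq_0_iff[of x "lc x p"] notin_vars_coeff_in[of x _ p]
            by (intro deg_below_mult deg_below_lead_rest) auto
          moreover have "deg_in x (lc x a' * xpow x (?n - ?m) + 0) = ?n - ?m"
            by (rule deg_in_lead) (auto simp: lc_nonzero a'0 notin_vars_coeff_in deg_below_def)
          then have "deg_below x (?n - ?m + ?m) (lc x a' * xpow x (?n - ?m) * lead_rest x p)"
            by (intro deg_below_mult deg_below_lead_rest) auto
          ultimately have "deg_below x ?n s"
            unfolding s using ge by (intro deg_below_minus) auto
          then have "deg_in x s < ?n"
            using deg_in_less_iff[of ?n x s] ge dp by simp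
          moreover have "vars s \<subseteq> ?W"
          proof -
            have "vars (lc x p * a') \<subseteq> ?W"
              using vars_mult_subset[of "lc x p" a'] lcV[OF vars_p] va by blast
            moreover have "vars (lc x a' * xpow x (?n - ?m) * p) \<subseteq> ?W"
              using vars_mult_subset[of "lc x a' * xpow x (?n - ?m)" p]
                vars_mult_subset[of "lc x a'" "xpow x (?n - ?m)"] lcV[OF va] vars_p
                vars_xpow_subset[of x "?n - ?m"] by blast
            ultimately show ?thesis unfolding s_def by (rule order_trans[OF vars_minus_subset Un_least])
          qed
          moreover have "p dvd s * b'"
          proof -
            have "s * b' = lc x p * (a' * b') - p * (lc x a' * xpow x (?n - ?m) * b')"
              by (simp add: s_def algebra_simps)
            then show ?thesis using ab by (simp add: dvd_diff dvd_mult)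
          qed
          ultimately have "p dvd s \<or> p dvd b'"
            using less.hyps[of s b'] deg vb by simp
          \<comment> \<open>Going back from \<open>s\<close> only yields \<open>lc x p * a'\<close>.
            The factor \<open>lc x p\<close> can be cancelled because \<open>x\<close> occurs in
            \<open>p\<close> but not in \<open>lc x p\<close>.\<close>
          moreover have "p dvd a'" if "p dvd s"
          proof -
            have "lc x p * a' = s + lc x a' * xpow x (?n - ?m) * p" by (simp add: s_def)
            then have "p dvd lc x p * a'" using that by simp
            then show ?thesis
              using irreducible_dvd_cancel[OF free irr _ vars_p lc_nonzero[OF p0] lcV[OF vars_p] va]
                True x by blast
          qed
          ultimately show ?thesis by blast
        qed
        show ?thesis
        proof (cases "deg_in x p \<le> deg_in x a \<or> deg_in x p \<le> deg_in x b")
          case True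
          then show ?thesis
            using reduce[of a b] reduce[of b a] less.prems ab0 by (auto simp: ac_simps)
        next
          case small: False
          obtain q where q: "a * b = p * q" using less.prems(3) by (rule dvdE)
          then have q0: "q \<noteq> 0" using ab0 pol_mult_eq_0_iff[of a b] by auto
          \<comment> \<open>Both degrees on the left are below \<open>deg_in x p\<close>, hence so
            is the degree of \<open>q\<close>.\<close>
          have "deg_in x a + deg_in x b = deg_in x p + deg_in x q"
            using deg_in_mult[OF ab0, of x] deg_in_mult[OF p0 q0, of x] q by simp
          then have dq: "deg_in x q < deg_in x p" using small by simp
          have vq: "vars q \<subseteq> ?W"
            using vars_mult[OF ab0] vars_mult[OF p0 q0] q less.prems(1,2) by auto
          \<comment> \<open>The degree of \<open>r\<close> in \<open>x\<close> is at most that of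
            \<open>q\<close>, so the outer induction hypothesis makes \<open>r\<close>
            prime.\<close>
          have "prime_within ?W r" if r: "irreducible r" "r dvd q" for r
          proof -
            from r(2) obtain s where s: "q = r * s" by (rule dvdE)
            then have rs: "r \<noteq> 0" "s \<noteq> 0" using q0 by auto
            have "deg_in x r < deg_in x p" using dq deg_in_mult[OF rs, of x] s by simp
            moreover have "vars r \<subseteq> ?W" using vars_dvd_subset[OF r(2) q0] vq by blast
            ultimately show ?thesis using outer r(1) by blast
          qed
          then obtain a' b' where ab': "a' dvd a" "b' dvd b" "p = a' * b'"
            using refine_factorization[OF _ q[symmetric] p0 q0 less.prems(1,2)] by blast
          from irr ab'(3) have "a' dvd 1 \<or> b' dvd 1" by (rule irreducibleD)
          then show ?thesis
            using dvd_mult_unit_left[of a' b' b] dvd_mult_unit_left[of b' a' a] ab'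
            by (auto simp: mult.commute)
        qed
      qed auto
    qed
    then show ?thesis by (simp add: prime_within_def)
  qed
qed

lemma irreducible_imp_prime_within:
  fixes p :: "('v, 'k::field) pol"
  assumes "finite V" "irreducible p" "vars p \<subseteq> V"
  shows "prime_within V p"
  using assms
proof (induction V arbitrary: p rule: finite_induct)
  \<comment> \<open>Without variables an irreducible \<open>p\<close> would be a nonzero constant,
    hence a unit.\<close>
  case empty
  then show ?case using pol_dvd_1_iff[of p] by (auto simp: irreducible_def)
next
  case (insert x V)
  then show ?case using prime_within_insert_new[of V x p] by blast
qed

section \<open>Primality and divisibility in the full ring\<close>

text \<open>Only finitely many variables occur in \<open>p\<close>, \<open>a\<close> and
  \<open>b\<close>, so primality within a finite set of variables suffices for each pair
  \<open>a\<close>, \<open>b\<close>.\<close>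

theorem pol_irreducible_imp_prime_elem:
  fixes p :: "('v, 'k::field) pol"
  assumes "irreducible p"
  shows "prime_elem p"
proof (rule prime_elemI)
  fix a b assume "p dvd a * b"
  moreover have "prime_within (vars p \<union> vars a \<union> vars b) p"
    by (rule irreducible_imp_prime_within) (auto simp: assms)
  ultimately show "p dvd a \<or> p dvd b" by (auto simp: prime_within_def)
qed (use assms in \<open>auto simp: irreducible_def\<close>)

text \<open>Descent on \<open>c\<close>: an irreducible factor \<open>p\<close> of \<open>c\<close>
  lies in \<open>k[N]\<close>, so it does not divide \<open>f\<close>. Being prime it divides
  \<open>b\<close>, and it is cancelled from both \<open>c\<close> and \<open>b\<close>.\<close>

lemma dvd_of_mult_eq_mult:
  fixes b c f g :: "('v, 'k::field) pol"
  assumes "c * g = b * f" "c \<noteq> 0" "vars c \<subseteq> N"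
    and "\<And>h. vars h \<subseteq> N \<Longrightarrow> h dvd f \<Longrightarrow> vars h = {}"
  shows "c dvd b"
  using assms(1-3)
proof (induction "total_size c" arbitrary: b c rule: less_induct)
  case less
  show ?case
  proof (cases "c dvd 1")
    case True
    then show ?thesis by (meson dvd_trans one_dvd)
  next
    case False
    then obtain p where p: "irreducible p" "p dvd c"
      using irreducible_divisor_exists less.prems(2) by blast
    then obtain c' where c': "c = p * c'" by (meson dvdE)
    have nz: "p \<noteq> 0" "c' \<noteq> 0" using c' less.prems(2) by auto
    have v: "vars p \<subseteq> N" "vars c' \<subseteq> N" using vars_mult[OF nz] c' less.prems(3) by auto
    have "p dvd b * f" using less.prems(1) c' by (metis dvd_triv_left mult.assoc)
    then have "p dvd b \<or> p dvd f"
      using pol_irreducible_imp_prime_elem[OF p(1)] by (simp add: prime_elem_dvd_mult_iff)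
    moreover have "\<not> p dvd f"
      using assms(4)[OF v(1)] p(1) nz(1) pol_dvd_1_iff[of p] by (auto simp: irreducible_def)
    ultimately obtain b' where b': "b = p * b'" by (auto elim: dvdE)
    have "p * (c' * g) = p * (b' * f)" using less.prems(1) c' b' by (simp add: mult.assoc)
    then have "c' * g = b' * f" using pol_mult_left_cancel[OF nz(1)] by blast
    moreover have "total_size c' < total_size c"
      using total_size_mult[OF nz] c' p(1) total_size_eq_0_iff[of p] pol_dvd_1_iff[of p] nz
      by (simp add: irreducible_def)
    ultimately have "c' dvd b'" using less.hyps nz(2) v(2) by blast
    then show ?thesis unfolding c' b' by (rule mult_dvd_mono[OF dvd_refl])
  qed
qed


section \<open>Characteristic sets\<close>

lemma rankingD:
  assumes "ranking R"
  shows "linear_order R" "(u, derive_var \<theta> u) \<in> R"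
  using assms unfolding ranking_def by blast+

lemma rank_less_total:
  assumes "linear_order R"
  shows "p = q \<or> rank_less R p q \<or> rank_less R q p"
  using linear_orderD(4)[OF assms, of "fst p" "fst q"] unfolding rank_less_def
  by (metis linorder_neqE_nat prod.expand)

lemma rank_less_irrefl [simp]: "\<not> rank_less R p p"
  by (simp add: rank_less_def)

lemma leader_props:
  assumes R: "linear_order R" and f: "f \<notin> range Const"
  shows leader_in_vars: "leader R f \<in> vars f"
    and vars_le_leader: "v \<in> vars f \<Longrightarrow> (v, leader R f) \<in> R"
proof -
  have "vars f \<noteq> {}" using f vars_empty_iff by blast
  then obtain u where u: "u \<in> vars f" "\<forall>v\<in>vars f. (v, u) \<in> R"
    using finite_linear_order_max[OF R finite_vars] by blast
  have "leader R f = u" unfolding leader_def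
    by (rule the_equality) (use u linear_orderD(2)[OF R] in auto)
  with u show "leader R f \<in> vars f" "v \<in> vars f \<Longrightarrow> (v, leader R f) \<in> R" by auto
qed

lemma ldeg_pos:
  assumes "linear_order R" "f \<notin> range Const"
  shows "0 < ldeg R f"
  using leader_in_vars[OF assms] deg_in_eq_0_iff[of "leader R f" f] by (simp add: ldeg_def)

lemma initial_nonzero:
  assumes "f \<notin> range Const"
  shows "initial R f \<noteq> 0"
proof -
  have "f \<noteq> 0" using assms by (metis Const_0 rangeI)
  then show ?thesis unfolding initial_def ldeg_def by (rule lc_nonzero)
qed

lemma derive_var_zero [simp]: "derive_var 0 u = u"
  by (simp add: derive_var_def)

lemma derive_var_eq_self_iff [simp]: "derive_var \<theta> u = u \<longleftrightarrow> \<theta> = 0"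
  by (cases u) (auto simp: derive_var_def)

section \<open>Reducedness and lowest rank\<close>

lemma autoreduced_listD:
  assumes "autoreduced_list R A"
  shows "f \<in> set A \<Longrightarrow> f \<notin> range Const"
    and "f \<in> set A \<Longrightarrow> g \<in> set A \<Longrightarrow> f \<noteq> g \<Longrightarrow> reduced_wrt R f g"
    and "i < j \<Longrightarrow> j < length A \<Longrightarrow> rank_less R (rank R (A ! i)) (rank R (A ! j))"
  using assms unfolding autoreduced_list_def autoreduced_def by (auto simp: sorted_wrt_iff_nth_less)

lemma reduced_wrt_rank_neq:
  assumes "reduced_wrt R f g"
  shows "rank R f \<noteq> rank R g"
  using assms by (auto simp: reduced_wrt_def rank_def ldeg_def)

text \<open>All variables of \<open>g\<close> are at most the leader of \<open>g\<close>, which is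
  strictly below the leader of \<open>f\<close>; so neither the leader of \<open>f\<close> nor any
  derivative of it occurs in \<open>g\<close>.\<close>

lemma reduced_wrt_of_rank_less:
  assumes R: "ranking R" and f: "f \<notin> range Const" and g: "g \<notin> range Const"
    and red: "reduced_wrt R f g" and less: "rank_less R (rank R g) (rank R f)"
  shows "reduced_wrt R g f"
proof -
  note lin = rankingD(1)[OF R]
  \<comment> \<open>For equal leaders, \<open>less\<close> and \<open>red\<close> would give
    opposite inequalities between the degrees.\<close>
  have neq: "leader R g \<noteq> leader R f" and le: "(leader R g, leader R f) \<in> R"
    using less red by (auto simp: rank_less_def rank_def ldeg_def reduced_wrt_def)
  have notin: "derive_var \<theta> (leader R f) \<notin> vars g" for \<theta>
  proof
    assume "derive_var \<theta> (leader R f) \<in> vars g"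
    then have "(derive_var \<theta> (leader R f), leader R g) \<in> R" by (rule vars_le_leader[OF lin g])
    then have "(leader R f, leader R g) \<in> R"
      using rankingD(2)[OF R] linear_orderD(3)[OF lin] by blast
    with le neq show False using linear_orderD(2)[OF lin] by blast
  qed
  then have "deg_in (leader R f) g = 0" using notin[of 0] deg_in_eq_0_iff by fastforce
  then show ?thesis
    using notin ldeg_pos[OF lin f] by (simp add: reduced_wrt_def ldeg_def)
qed

text \<open>Truncating \<open>A\<close> at the rank of a reduced \<open>f \<in> I\<close> and appending \<open>f\<close> would give an autoreduced
  set of lower rank.\<close>

lemma characteristic_set_reduced_Const:
  fixes I :: "('d, 'y, 'k::zero) dpol set"
  assumes R: "ranking R" and A: "characteristic_set R I A" and f: "f \<in> I"
    and red: "\<And>g. g \<in> set A \<Longrightarrow> reduced_wrt R f g"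
  shows "f \<in> range Const"
proof (rule ccontr)
  assume fC: "f \<notin> range Const"
  note lin = rankingD(1)[OF R]
  have al: "autoreduced_list R A" and AI: "set A \<subseteq> I"
    and min: "\<And>B. autoreduced_list R B \<Longrightarrow> set B \<subseteq> I \<Longrightarrow> \<not> lower_rank R B A"
    using A unfolding characteristic_set_def by blast+
  define P where "P = (\<lambda>g :: ('d, 'y, 'k) dpol. rank_less R (rank R g) (rank R f))"
  \<comment> \<open>The longest initial segment of \<open>A\<close> with ranks below that of
    \<open>f\<close>, so that appending \<open>f\<close> keeps the list sorted.\<close>
  define T where "T = takeWhile P A"
  have T: "set T \<subseteq> set A" "\<And>g. g \<in> set T \<Longrightarrow> P g"
    unfolding T_def by (auto dest: set_takeWhileD)
  have Tn: "T = take (length T) A" unfolding T_def by (rule takeWhile_eq_take)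
  have len: "length T \<le> length A" unfolding T_def by (rule length_takeWhile_le)
  have nth: "i < length T \<Longrightarrow> T ! i = A ! i" for i
    unfolding T_def by (rule takeWhile_nth)
  have sortA: "sorted_wrt (\<lambda>f g. rank_less R (rank R f) (rank R g)) A"
    using al by (simp add: autoreduced_list_def)
  then have "sorted_wrt (\<lambda>f g. rank_less R (rank R f) (rank R g)) T"
    using Tn by (metis sorted_wrt_take)
  then have sorted: "sorted_wrt (\<lambda>f g. rank_less R (rank R f) (rank R g)) (T @ [f])"
    using T(2) by (simp add: sorted_wrt_append P_def)
  have "autoreduced R (set (T @ [f]))"
    unfolding autoreduced_def
  proof (intro conjI ballI impI)
    show "set (T @ [f]) \<inter> range Const = {}"
      using autoreduced_listD(1)[OF al] T(1) fC by auto
    fix g h assume gh: "g \<in> set (T @ [f])" "h \<in> set (T @ [f])" "g \<noteq> h"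
    then consider "g \<in> set T" "h \<in> set T" | "g = f" "h \<in> set T" | "g \<in> set T" "h = f"
      by auto
    then show "reduced_wrt R g h"
    proof cases
      case 1
      then show ?thesis using autoreduced_listD(2)[OF al _ _ gh(3)] T(1) by blast
    next
      case 2
      then show ?thesis using red T(1) by blast
    next
      case 3
      then have "g \<in> set A" "rank_less R (rank R g) (rank R f)" using T by (auto simp: P_def)
      then show ?thesis
        using reduced_wrt_of_rank_less[OF R fC autoreduced_listD(1)[OF al]] red 3(2) by blast
    qed
  qed
  then have "autoreduced_list R (T @ [f])" using sorted by (simp add: autoreduced_list_def)
  moreover have "set (T @ [f]) \<subseteq> I" using T(1) AI f by auto
  moreover have "lower_rank R (T @ [f]) A"
  proof (cases "length T < length A")
    case True
    \<comment> \<open>The first dropped element does not rank below \<open>f\<close>, and it does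
      not have the same rank because \<open>f\<close> is reduced with respect to it; so
      \<open>f\<close> ranks lower at this position.\<close>
    then have "\<not> P (A ! length T)"
      unfolding T_def by (rule nth_length_takeWhile)
    moreover have "rank R f \<noteq> rank R (A ! length T)"
      using reduced_wrt_rank_neq red True nth_mem by blast
    ultimately have "rank_less R (rank R f) (rank R (A ! length T))"
      using rank_less_total[OF lin] unfolding P_def by metis
    then show ?thesis unfolding lower_rank_def
      using True nth by (intro disjI1 exI[of _ "length T"]) (auto simp: nth_append)
  next
    case False
    \<comment> \<open>Nothing was dropped, so the new list properly extends \<open>A\<close>, which
      counts as lower rank.\<close>
    then have "length T = length A" using len by simp
    then show ?thesis unfolding lower_rank_def
      using nth by (intro disjI2) (auto simp: nth_append)
  qed
  ultimately show False using min by blast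
qed

text \<open>At the first position where the ranks differ, one of the two lists would be lower than
  the other.\<close>

lemma characteristic_set_same_rank:
  assumes R: "ranking R" and A: "characteristic_set R I A" and B: "characteristic_set R I B"
    and i: "i < length A"
  shows "rank R (A ! i) = rank R (B ! i)"
  using i
proof (induction i rule: less_induct)
  case (less i)
  have len: "length A = length B" by (rule characteristic_set_same_length[OF R A B])
  have nl: "\<not> lower_rank R A B" "\<not> lower_rank R B A"
    using A B unfolding characteristic_set_def by blast+
  have eq: "\<forall>j<i. rank R (A ! j) = rank R (B ! j)" using less by simp
  have "\<not> rank_less R (rank R (A ! i)) (rank R (B ! i))"
    using nl(1) eq less.prems len unfolding lower_rank_def by auto
  moreover have "\<not> rank_less R (rank R (B ! i)) (rank R (A ! i))"
    using nl(2) eq less.prems len unfolding lower_rank_def by auto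
  ultimately show ?case using rank_less_total[OF rankingD(1)[OF R]] by blast
qed

lemma nonleaders_not_derivative:
  assumes "f \<in> set A" "v \<in> nonleaders R A"
  shows "v \<noteq> derive_var \<theta> (leader R f)"
  using assms unfolding nonleaders_def by blast

lemma nonleaders_reduced:
  assumes R: "linear_order R" and f: "vars f \<subseteq> nonleaders R A"
    and g: "g \<in> set A" "g \<notin> range Const"
  shows "reduced_wrt R f g"
proof -
  have "derive_var \<theta> (leader R g) \<notin> vars f" for \<theta>
    using f nonleaders_not_derivative[OF g(1)] by blast
  \<comment> \<open>The case \<open>\<theta> = 0\<close> excludes the leader itself.\<close>
  moreover from this[of 0] have "deg_in (leader R g) f = 0" by (simp add: deg_in_eq_0_iff)
  ultimately show ?thesis
    using ldeg_pos[OF R g(2)] by (simp add: reduced_wrt_def ldeg_def)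
qed

section \<open>Lexicographic comparison of a polynomial with its multiples\<close>

text \<open>A constant \<open>g\<close> leaves the set of monomials unchanged. Otherwise the leading
  monomial of \<open>f * g\<close> exceeds every monomial of \<open>f\<close>, so it is the largest
  one in the symmetric difference.\<close>

lemma lex_le_mult:
  fixes f g :: "('v, 'k::field) pol"
  assumes R: "linear_order R" and f: "f \<noteq> 0" and g: "g \<noteq> 0"
  shows "lex_le R f (f * g)"
proof (cases "vars g = {}")
  case True
  then obtain c where c: "g = Const c" using vars_empty_iff[of g] by blast
  with g have "c \<noteq> 0" by auto
  have "keys h \<subseteq> keys (h * Const c)" if "c \<noteq> 0" for h :: "('v, 'k) pol" and c
  proof -
    have "keys (h * Const c * Const (inverse c)) \<subseteq> keys (h * Const c)"
      using keys_mult[of "h * Const c" "Const (inverse c)"]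
      by (auto simp: Const_def split: if_splits)
    then show ?thesis using that by (simp add: Const_def mult.assoc mult_single)
  qed
  moreover have "keys (f * Const c) \<subseteq> keys f"
    using keys_mult[of f "Const c"] by (auto simp: Const_def split: if_splits)
  ultimately have "keys f = keys (f * g)" using c \<open>c \<noteq> 0\<close> by blast
  then show ?thesis by (simp add: lex_le_def)
next
  case False
  obtain m where m: "is_lex_max R (keys f) m"
    using is_lex_max_exists[OF R, of "keys f"] f by auto
  obtain n where n: "is_lex_max R (keys g) n"
    using is_lex_max_exists[OF R, of "keys g"] g by auto
  have mn: "is_lex_max R (keys (f * g)) (m + n)" by (rule is_lex_max_mult[OF R m n])
  \<comment> \<open>The monomial 1 is the least one, so it is leading only in constants.\<close>
  have "n \<noteq> 0"
  proof
    assume "n = 0"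
    obtain k where "k \<in> keys g" "k \<noteq> 0" using False by (auto simp: vars_def)
    then have "lex_less R k 0" using n \<open>k \<in> keys g\<close> \<open>n = 0\<close> by (auto simp: is_lex_max_def)
    then show False by (simp add: lex_less_def)
  qed
  then have "lex_less R m (m + n)"
    using lex_less_add_right[OF lex_less_zero[OF R], of n m] by (simp add: add.commute)
  then have big: "lex_less R k (m + n)" if "k \<in> keys f" for k
    using that m lex_less_trans[OF R, of k m "m + n"] unfolding is_lex_max_def by (cases "k = m") auto
  then have "m + n \<notin> keys f" using lex_less_irrefl by blast
  moreover have "is_lex_max R (keys f - keys (f * g) \<union> (keys (f * g) - keys f)) (m + n)"
    using mn big \<open>m + n \<notin> keys f\<close> unfolding is_lex_max_def by blast
  ultimately show ?thesis using mn unfolding lex_le_def is_lex_max_def by blast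
qed

section \<open>Cross-multiplication and the comparison of initials\<close>

lemma differential_ideal_closed:
  assumes "differential_ideal \<delta> J"
  shows "f \<in> J \<Longrightarrow> g * f \<in> J" "f \<in> J \<Longrightarrow> g \<in> J \<Longrightarrow> f - g \<in> J"
proof -
  show *: "g * f \<in> J" if "f \<in> J" for f g using that assms by (auto simp: differential_ideal_def)
  show "f - g \<in> J" if "f \<in> J" "g \<in> J"
  proof -
    have "f + (- 1) * g \<in> J" using that *[of g "- 1"] assms by (auto simp: differential_ideal_def)
    then show ?thesis by simp
  qed
qed

text \<open>Cross-multiplying with the initials cancels the leading terms, so the difference lies in \<open>I\<close> and
  is reduced.\<close>

lemma characteristic_set_cross_mult:
  fixes A B :: "('d, 'y, 'k::field) dpol list"
  assumes R: "ranking R" and I: "differential_ideal \<delta> I" "1 \<notin> I"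
    and A: "characteristic_set R I A" and B: "characteristic_set R I B"
    and i: "i < length A"
    and iA: "vars (initial R (A ! i)) \<subseteq> nonleaders R A"
    and iB: "vars (initial R (B ! i)) \<subseteq> nonleaders R A"
  shows "initial R (A ! i) * B ! i = initial R (B ! i) * A ! i"
proof -
  note lin = rankingD(1)[OF R]
  have alA: "autoreduced_list R A" "set A \<subseteq> I" and alB: "autoreduced_list R B" "set B \<subseteq> I"
    using A B by (auto simp: characteristic_set_def)
  have len: "length A = length B" by (rule characteristic_set_same_length[OF R A B])
  have rk: "rank R (A ! j) = rank R (B ! j)" if "j < length A" for j
    by (rule characteristic_set_same_rank[OF R A B that])
  have in_sets: "A ! j \<in> set A" "B ! j \<in> set B" if "j < length A" for j
    using that len by auto
  let ?a = "initial R (A ! i)" and ?b = "initial R (B ! i)"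
  let ?D = "?a * B ! i - ?b * A ! i"
  have "?D \<in> I"
    using differential_ideal_closed[OF I(1)] in_sets[OF i] alA(2) alB(2) by blast
  moreover have "reduced_wrt R ?D g" if g: "g \<in> set A" for g
  proof -
    obtain j where j: "j < length A" "g = A ! j" using g by (auto simp: in_set_conv_nth)
    let ?u = "leader R g"
    have gC: "g \<notin> range Const" by (rule autoreduced_listD(1)[OF alA(1) g])
    have uB: "?u = leader R (B ! j)" and dB: "ldeg R g = ldeg R (B ! j)"
      using rk[OF j(1)] j(2) by (auto simp: rank_def)
    have free: "derive_var \<theta> ?u \<notin> vars ?a" "derive_var \<theta> ?u \<notin> vars ?b" for \<theta>
      using iA iB nonleaders_not_derivative[OF g] by blast+
    have deg0: "deg_in ?u ?a \<le> 0" "deg_in ?u ?b \<le> 0"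
      using free[of 0] by (simp_all add: deg_in_eq_0_iff)
    have red: "reduced_wrt R (A ! i) (A ! j)" "reduced_wrt R (B ! i) (B ! j)" if "i \<noteq> j"
    proof -
      have "A ! i \<noteq> A ! j" "B ! i \<noteq> B ! j"
        using autoreduced_listD(3)[OF alA(1), of i j] autoreduced_listD(3)[OF alA(1), of j i]
          autoreduced_listD(3)[OF alB(1), of i j] autoreduced_listD(3)[OF alB(1), of j i]
          that i j(1) len by (metis linorder_neqE_nat rank_less_irrefl)+
      then show "reduced_wrt R (A ! i) (A ! j)" "reduced_wrt R (B ! i) (B ! j)"
        using autoreduced_listD(2)[OF alA(1)] autoreduced_listD(2)[OF alB(1)]
          in_sets i j(1) by blast+
    qed
    have notin: "derive_var \<theta> ?u \<notin> vars ?D" if \<theta>: "\<theta> \<noteq> 0" for \<theta>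
    proof -
      have "derive_var \<theta> ?u \<notin> vars (A ! i) \<and> derive_var \<theta> ?u \<notin> vars (B ! i)"
      proof (cases "i = j")
        case True
        \<comment> \<open>A proper derivative of the leader ranks above every variable of
          \<open>f\<close>.\<close>
        have "derive_var \<theta> (leader R f) \<notin> vars f" if "f \<notin> range Const" for f
        proof
          assume "derive_var \<theta> (leader R f) \<in> vars f"
          then have "derive_var \<theta> (leader R f) = leader R f"
            using vars_le_leader[OF lin that] rankingD(2)[OF R] linear_orderD(2)[OF lin] by metis
          then show False using \<theta> by simp
        qed
        then show ?thesis
          using autoreduced_listD(1)[OF alA(1) in_sets(1)[OF i]]
            autoreduced_listD(1)[OF alB(1) in_sets(2)[OF i]] True j(2) uB by metis
      next
        case False
        then show ?thesis using red \<theta> j(2) uB by (auto simp: reduced_wrt_def)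
      qed
      then show ?thesis
        using free[of \<theta>] vars_minus_subset[of "?a * B ! i" "?b * A ! i"]
          vars_mult_subset[of ?a "B ! i"] vars_mult_subset[of ?b "A ! i"] by blast
    qed
    have "deg_below ?u (ldeg R g) ?D"
    proof (cases "i = j")
      case True
      let ?d = "ldeg R g"
      have a: "?a = lc ?u g" and dg: "deg_in ?u g = ?d" "deg_in ?u (B ! i) = ?d"
        and b: "?b = lc ?u (B ! i)"
        using True j(2) uB dB by (auto simp: initial_def ldeg_def)
      \<comment> \<open>Once the leading terms are split off, \<open>?a * ?b * xpow ?u ?d\<close>
        occurs twice with opposite signs.\<close>
      have "?D = ?a * (?b * xpow ?u ?d + lead_rest ?u (B ! i))
          - ?b * (?a * xpow ?u ?d + lead_rest ?u g)"
        using lead_decomp[of "B ! i" ?u] lead_decomp[of g ?u] a b dg True j(2) by simp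
      also have "\<dots> = ?a * lead_rest ?u (B ! i) - ?b * lead_rest ?u g"
        by (simp add: algebra_simps)
      finally have D: "?D = ?a * lead_rest ?u (B ! i) - ?b * lead_rest ?u g" .
      have "deg_below ?u (0 + ?d) (?a * lead_rest ?u (B ! i))"
        "deg_below ?u (0 + ?d) (?b * lead_rest ?u g)"
        using deg_below_lead_rest[of ?u "B ! i"] deg_below_lead_rest[of ?u g] dg
        by (intro deg_below_mult deg0; simp)+
      then show ?thesis unfolding D by (simp add: deg_below_minus)
    next
      case False
      \<comment> \<open>Here nothing has to cancel: both elements already have degree below
        \<open>ldeg R g\<close>, and the initials have degree 0 in \<open>?u\<close>.\<close>
      from red[OF this] have "deg_in ?u (A ! i) < ldeg R g" "deg_in ?u (B ! i) < ldeg R g"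
        unfolding reduced_wrt_def using j(2) uB dB by (simp_all add: ldeg_def)
      then have "deg_below ?u (ldeg R g) (A ! i)" "deg_below ?u (ldeg R g) (B ! i)"
        unfolding deg_in_less_iff[OF ldeg_pos[OF lin gC]] .
      then have "deg_below ?u (0 + ldeg R g) (?a * B ! i)" "deg_below ?u (0 + ldeg R g) (?b * A ! i)"
        by (intro deg_below_mult deg0; simp)+
      then show ?thesis by (simp add: deg_below_minus)
    qed
    then have "deg_in ?u ?D < ldeg R g" unfolding deg_in_less_iff[OF ldeg_pos[OF lin gC]] .
    then show ?thesis using notin unfolding reduced_wrt_def ldeg_def by blast
  qed
  ultimately have "?D \<in> range Const" by (rule characteristic_set_reduced_Const[OF R A])
  then obtain c where c: "?D = Const c" by blast
  have "c = 0"
  proof (rule ccontr)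
    assume "c \<noteq> 0"
    then have "?D dvd 1" unfolding c by (rule Const_dvd_1)
    then obtain h where "1 = ?D * h" by (rule dvdE)
    then have "1 = h * ?D" by (simp only: mult.commute)
    then show False using \<open>?D \<in> I\<close> differential_ideal_closed(1)[OF I(1)] I(2) by metis
  qed
  then show ?thesis using c by simp
qed

theorem proposition4:
  fixes \<delta> :: "'d::finite \<Rightarrow> 'k \<Rightarrow> 'k::field_char_0"
    and R :: "('d, 'y::finite) dvar rel"
    and I :: "('d, 'y, 'k) dpol set"
    and C B :: "('d, 'y, 'k) dpol list"
    and N :: "('d, 'y) dvar set"
    and p :: nat
  assumes "commuting_derivations \<delta>"
    and "ranking R"
    and "characterizable \<delta> R I"
    and "canonical_characteristic_set R I C"
    and "length C = p"
    and "N = nonleaders R C"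
    and "characteristic_set R I B"
    and "\<forall>f\<in>set B. initial R f \<in> pol_ring_in N"
  shows "\<forall>i<p. lex_le R (initial R (C ! i)) (initial R (B ! i))"
proof (intro allI impI)
  fix i assume "i < p"
  note R = assms(2) and B = assms(7)
  note lin = rankingD(1)[OF R]
  have C: "characteristic_set R I C" using assms(4) by (simp add: canonical_characteristic_set_def)
  have I: "differential_ideal \<delta> I" using assms(3) by (simp add: characterizable_def)
  have len: "length B = length C" by (rule characteristic_set_same_length[OF R B C])
  then have i: "i < length C" and Ci: "C ! i \<in> set C" and Bi: "B ! i \<in> set B"
    using \<open>i < p\<close> assms(5) by auto
  let ?c = "initial R (C ! i)" and ?b = "initial R (B ! i)"
  have nonconst: "f \<notin> range Const" if "f \<in> set C \<or> f \<in> set B" for f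
    using that B C autoreduced_listD(1) unfolding characteristic_set_def by blast
  have nz: "?c \<noteq> 0" "?b \<noteq> 0" using nonconst Ci Bi initial_nonzero by blast+
  have vc: "vars ?c \<subseteq> N" and vb: "vars ?b \<subseteq> N"
    using assms(4,6,8) Ci Bi by (auto simp: canonical_characteristic_set_def pol_ring_in_def)
  have "?c dvd ?b"
  proof (cases "1 \<in> I")
    case True
    \<comment> \<open>In the unit ideal, \<open>?c\<close> itself belongs to \<open>I\<close> and is
      reduced with respect to \<open>C\<close>, as it involves non-leaders only; so it is a nonzero
      constant.\<close>
    then have "?c \<in> I" using differential_ideal_closed(1)[OF I, of 1 ?c] by simp
    then have "?c \<in> range Const"
      using characteristic_set_reduced_Const[OF R C] nonleaders_reduced[OF lin] vc assms(6)
        nonconst by blast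
    then have "?c dvd 1" using nz(1) by (simp add: pol_dvd_1_iff vars_empty_iff)
    then show ?thesis by (meson dvd_trans one_dvd)
  next
    case False
    have "?c * B ! i = ?b * C ! i"
      using characteristic_set_cross_mult[OF R I False C B i] vc vb assms(6) by blast
    \<comment> \<open>This is the canonicity condition that excludes nonconstant factors in
      \<open>k[N]\<close>.\<close>
    moreover have "vars h = {}" if "vars h \<subseteq> N" "h dvd C ! i" for h
      using that assms(4,6) Ci
      by (auto simp: canonical_characteristic_set_def pol_ring_in_def vars_empty_iff)
    ultimately show ?thesis using dvd_of_mult_eq_mult nz(1) vc by blast
  qed
  then obtain q where q: "?b = ?c * q" by (rule dvdE)
  then have "q \<noteq> 0" using nz(2) by auto
  then show "lex_le R ?c ?b" unfolding q by (rule lex_le_mult[OF lin nz(1)])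
qed

end
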